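(* Let $\alpha>0$ and $N_k=\lambda^k$, where $\lambda>1$. There exists a non-negative solution $X=(X_k)_{k\ge1}$ of $$X_k'=N_k^\alpha X_{k+1}^2-N_{k-1}^\alpha X_{k-1}X_k,\qquad k\ge1,\qquad X_0=0,$$ componentwise classical on $(0,\infty)$, such that, after setting $X(0)=0$, $$X\in C([0,\infty);H^s)\ \text{ for every } s<0,\qquad X\in C((0,\infty);H^s)\ \text{ for every } s<\alpha,$$ and $$\lim_{t\to0+}\|X(t)\|_{H^s}=0\ \text{ for every } s<0,\qquad \|X(t)\|_{\ell^2}=1\ \text{ for every } t>0.$$ Moreover, for every $0<r<\alpha$, there exist constants $c_r,t_r>0$ such that $$\|X(t)\|_{H^r}\ge c_rt^{-r/\alpha},\qquad 0<t\le t_r.$$ Consequently, for every $s<0$, the zero solution and $X$ are distinct componentwise solutions in $C([0,\infty);H^s)$ with the same initial value.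
   Context: For a real sequence $X=(X_k)_{k\ge1}$ and $s\in\mathbb R$, $\|X\|_{H^s}^2:=\sum_{k\ge1}N_k^{2s}X_k^2$, $H^s$ is the space of sequences with finite norm, and $H^0=\ell^2$. Convention $N_0=1$ (immaterial, since $X_0=0$). Componentwise classical means that each $X_k$ is a $C^1$ function of time satisfying the $k$-th differential equation. Non-negative means $X_k(t)\ge0$ for all $k$ and $t$. *)

theory Defs
  imports "HOL-Analysis.Analysis"
begin

text \<open>
  Sequences \<open>(x\<^sub>k)\<close> with \<open>k \<ge> 1\<close> are functions of type \<open>nat \<Rightarrow> real\<close>. The value at
  index \<open>0\<close> never enters the norms; for solutions it is the boundary value \<open>X\<^sub>0 = 0\<close>.
\<close>

definition freq :: "real \<Rightarrow> nat \<Rightarrow> real" where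
  "freq lam k = lam ^ k"

definition H_space :: "real \<Rightarrow> real \<Rightarrow> (nat \<Rightarrow> real) set" where
  "H_space lam s = {x. (\<lambda>k. freq lam k powr (2 * s) * (x k)\<^sup>2) summable_on {1..}}"

text \<open>Only meaningful on \<open>H_space lam s\<close>: a divergent sum has the value \<open>0\<close> here.\<close>

definition H_norm :: "real \<Rightarrow> real \<Rightarrow> (nat \<Rightarrow> real) \<Rightarrow> real" where
  "H_norm lam s x = sqrt (\<Sum>\<^sub>\<infinity>k\<in>{1..}. freq lam k powr (2 * s) * (x k)\<^sup>2)"

abbreviation l2_norm :: "real \<Rightarrow> (nat \<Rightarrow> real) \<Rightarrow> real" where
  "l2_norm lam \<equiv> H_norm lam 0"

definition continuous_into_H ::
    "real \<Rightarrow> real \<Rightarrow> real set \<Rightarrow> (real \<Rightarrow> nat \<Rightarrow> real) \<Rightarrow> bool" where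
  "continuous_into_H lam s I X \<longleftrightarrow>
     (\<forall>t\<in>I. X t \<in> H_space lam s) \<and>
     (\<forall>t\<in>I. ((\<lambda>u. H_norm lam s (\<lambda>k. X u k - X t k)) \<longlongrightarrow> 0) (at t within I))"

definition dyadic_rhs :: "real \<Rightarrow> real \<Rightarrow> (nat \<Rightarrow> real) \<Rightarrow> nat \<Rightarrow> real" where
  "dyadic_rhs \<alpha> lam x k =
     freq lam k powr \<alpha> * (x (k + 1))\<^sup>2 - freq lam (k - 1) powr \<alpha> * x (k - 1) * x k"

text \<open>
  Derivatives are taken within \<open>I\<close>: two-sided on the open half-line \<open>{0<..}\<close>, one-sided
  at the left endpoint of \<open>{0..}\<close>.
\<close>

definition componentwise_solution ::
    "real \<Rightarrow> real \<Rightarrow> real set \<Rightarrow> (real \<Rightarrow> nat \<Rightarrow> real) \<Rightarrow> bool" where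
  "componentwise_solution \<alpha> lam I X \<longleftrightarrow>
     (\<forall>t\<in>I. X t 0 = 0) \<and>
     (\<forall>k\<ge>1. \<exists>D. continuous_on I D \<and>
        (\<forall>t\<in>I. ((\<lambda>u. X u k) has_real_derivative D t) (at t within I) \<and>
               D t = dyadic_rhs \<alpha> lam (X t) k))"

end

theory Submission
  imports Defs "HOL-Complex_Analysis.Great_Picard"
begin

text \<open>
  Write \<open>a = lam powr \<alpha>\<close>, so that the system is
  \<open>X\<^sub>k' = a ^ k * X\<^sub>k\<^sub>+\<^sub>1\<^sup>2 - a ^ (k - 1) * X\<^sub>k\<^sub>-\<^sub>1 * X\<^sub>k\<close>; energy flows from high to low modes.
  Let \<open>x\<^sub>n\<close> be the solution started from the unit vector \<open>e\<^sub>n\<close>. It lives on the modes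
  \<open>1, \<dots>, n\<close>, is non-negative and has \<open>\<ell>\<^sup>2\<close> norm \<open>1\<close> at all times, and \<open>X\<close> is a componentwise
  limit of a subsequence of the \<open>x\<^sub>n\<close>. What has to be shown is that no energy remains at
  \<open>k = \<infinity>\<close> when \<open>t > 0\<close>, that is, a bound on \<open>Q\<^sub>c = (\<Sum>k. c ^ k * x\<^sub>k\<^sup>2)\<close> for \<open>c > 1\<close>, uniformly in \<open>n\<close>.

  One has \<open>Q\<^sub>c' = - 2 * (c - 1) * A\<^sub>c\<close> with \<open>A\<^sub>c = (\<Sum>k. (c * a) ^ k * x\<^sub>k * x\<^sub>k\<^sub>+\<^sub>1\<^sup>2) \<ge> 0\<close>, so a bound on \<open>Q\<^sub>c\<close>
  with \<open>c \<noteq> 1\<close> bounds the time integral of the cubic quantity \<open>A\<^sub>c\<close>. Together with the evolution of the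
  linear quantity \<open>\<Sum>k. (d / a) ^ k * x\<^sub>k\<close> and Young's inequality this bounds the time
  integral of \<open>Q\<^sub>d\<close>, hence its final value, as soon as \<open>d ^ 3 < (c * a)\<^sup>2\<close>. Starting at \<open>c < 1\<close>,
  where \<open>Q\<^sub>c \<le> 1\<close> is trivial, and iterating, one reaches every \<open>c < a\<^sup>2\<close>, which is the regularity
  \<open>H\<^sup>s\<close> for every \<open>s < \<alpha>\<close>.
\<close>

section \<open>Global solutions of Lipschitz differential equations\<close>

lemma integral_has_vector_derivative_atLeast:
  fixes h :: "real \<Rightarrow> 'a::banach"
  assumes "continuous_on {0..} h" and "t \<ge> 0"
  shows "((\<lambda>u. integral {0..u} h) has_vector_derivative h t) (at t within {0..})"
proof -
  have "((\<lambda>u. integral {0..u} h) has_vector_derivative h t) (at t within {0..t+1})"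
    using assms by (intro integral_has_vector_derivative) (auto intro: continuous_on_subset)
  moreover have "at t within {0..t+1} = at t within {0..}"
    by (rule at_within_nhd[of _ "{..<t+1}"]) auto
  ultimately show ?thesis by simp
qed

text \<open>Integrating \<open>exp (M * s)\<close> gains a factor \<open>1 / M\<close>. This gain
  yields both the boundedness of the weighted Picard iterates and the contraction constant.\<close>

lemma norm_integral_le_exp:
  fixes g :: "real \<Rightarrow> 'a::banach"
  assumes g: "continuous_on {0..t} g" and "t \<ge> 0" and "M > 0"
    and le: "\<And>s. s \<in> {0..t} \<Longrightarrow> norm (g s) \<le> C * exp (M * s)"
  shows "norm (exp (- M * t) *\<^sub>R integral {0..t} g) \<le> C / M"
proof -
  have *: "((\<lambda>s. C * exp (M * s)) has_integral (C * exp (M * t) / M - C * exp (M * 0) / M)) {0..t}"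
    using assms(2,3)
    by (intro fundamental_theorem_of_calculus)
      (auto simp: has_real_derivative_iff_has_vector_derivative[symmetric] intro!: derivative_eq_intros)
  have C: "C \<ge> 0"
    using order_trans[OF norm_ge_zero le[of 0]] \<open>t \<ge> 0\<close> by simp
  have "norm (integral {0..t} g) \<le> integral {0..t} (\<lambda>s. C * exp (M * s))"
    using g * le by (intro integral_norm_bound_integral) (auto intro: integrable_continuous_interval)
  also have "\<dots> = C * exp (M * t) / M - C / M" using integral_unique[OF *] by simp
  also have "\<dots> \<le> C * exp (M * t) / M" using C \<open>M > 0\<close> by simp
  finally have "exp (- M * t) * norm (integral {0..t} g) \<le> exp (- M * t) * (C * exp (M * t) / M)"
    by (intro mult_left_mono) auto
  also have "\<dots> = C / M" by (simp add: exp_minus field_simps)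
  finally show ?thesis by simp
qed

text \<open>Banach's fixed point theorem applied to \<open>v t = exp (- M * t) *\<^sub>R u t\<close>: this weight makes the
  Picard operator a contraction on the whole half-line at once.\<close>

lemma lipschitz_ode_global_solution:
  fixes F :: "'a::banach \<Rightarrow> 'a"
  assumes "L-lipschitz_on UNIV F"
  obtains u where "u 0 = x0"
    and "\<And>t. t \<ge> 0 \<Longrightarrow> (u has_vector_derivative F (u t)) (at t within {0..})"
proof -
  \<comment> \<open>Adding 1 keeps \<open>K\<close> positive even for \<open>L = 0\<close>; with
    \<open>M = 2 * K\<close> the contraction factor \<open>K / M\<close> is 1/2.\<close>
  define K where "K = L + 1"
  define M where "M = 2 * K"
  have KL: "K > 0" and M0: "M > 0" and L0: "L \<ge> 0"
    using lipschitz_on_nonneg[OF assms] by (auto simp: K_def M_def)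
  have Lip: "norm (F x - F y) \<le> K * norm (x - y)" for x y
  proof -
    have "norm (F x - F y) \<le> L * norm (x - y)"
      using lipschitz_onD[OF assms, of x y] by (simp add: dist_norm)
    also have "\<dots> \<le> K * norm (x - y)" by (intro mult_right_mono) (auto simp: K_def)
    finally show ?thesis .
  qed
  have Fcont: "continuous_on S F" for S
    using lipschitz_on_continuous_on[OF assms] continuous_on_subset by blast
  define h where "h v s = F (exp (M * s) *\<^sub>R v s)" for v :: "real \<Rightarrow> 'a" and s
  have hcont: "continuous_on S (h v)" if "continuous_on UNIV v" for v S
    unfolding h_def
    by (rule continuous_on_compose2[OF Fcont[of UNIV]])
      (auto intro!: continuous_intros continuous_on_subset[OF that])
  define J where "J v t = integral {0..t} (h v)" for v t
  have Jderiv: "(J v has_vector_derivative h v t) (at t within {0..})"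
    if "continuous_on UNIV v" "t \<ge> 0" for v t
    unfolding J_def by (rule integral_has_vector_derivative_atLeast[OF hcont[OF that(1)] that(2)])
  \<comment> \<open>Bounded continuous functions live on the whole line here, so
    \<open>max 0 t\<close> extends the operator to negative times by its value at 0.\<close>
  define \<Psi> where "\<Psi> v t = exp (- M * max 0 t) *\<^sub>R (x0 + J v (max 0 t))" for v t
  have \<Psi>: "\<Psi> v \<in> bcontfun" if v: "continuous_on UNIV v" "bounded (range v)" for v
  proof -
    have "continuous_on {0..} (J v)"
      using Jderiv[OF v(1)] by (intro continuous_on_vector_derivative[of _ _ "h v"]) auto
    then have "continuous_on UNIV (\<lambda>t. J v (max 0 t))"
      by (rule continuous_on_compose2) (auto intro!: continuous_intros)
    then have c: "continuous_on UNIV (\<Psi> v)"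
      unfolding \<Psi>_def by (intro continuous_intros) auto
    obtain B where B: "\<And>s. norm (v s) \<le> B"
      using v(2) by (auto simp: bounded_iff)
    have B0: "B \<ge> 0" using B[of 0] norm_ge_zero order_trans by blast
    have "norm (\<Psi> v t) \<le> norm x0 + (norm (F 0) + K * B) / M" for t
    proof -
      have "norm (h v s) \<le> (norm (F 0) + K * B) * exp (M * s)" if "s \<in> {0..max 0 t}" for s
      proof -
        have "norm (h v s) \<le> norm (F 0) + norm (h v s - F 0)"
          by (metis add.commute diff_add_cancel norm_triangle_ineq)
        also have "\<dots> \<le> norm (F 0) + K * norm (exp (M * s) *\<^sub>R v s)"
          unfolding h_def using Lip[of "exp (M * s) *\<^sub>R v s" 0] by simp
        also have "\<dots> \<le> norm (F 0) * exp (M * s) + K * (exp (M * s) * B)"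
        proof (rule add_mono)
          show "norm (F 0) \<le> norm (F 0) * exp (M * s)"
            using that M0 by (simp add: mult_le_cancel_left1)
          show "K * norm (exp (M * s) *\<^sub>R v s) \<le> K * (exp (M * s) * B)"
            using KL B by (intro mult_left_mono) auto
        qed
        finally show ?thesis by (simp add: algebra_simps)
      qed
      then have "norm (exp (- M * max 0 t) *\<^sub>R J v (max 0 t)) \<le> (norm (F 0) + K * B) / M"
        unfolding J_def by (intro norm_integral_le_exp hcont v M0) auto
      moreover have "norm (exp (- M * max 0 t) *\<^sub>R x0) \<le> norm x0"
        using M0 by (simp add: mult_left_le_one_le)
      ultimately show ?thesis
        unfolding \<Psi>_def scaleR_right_distrib using norm_triangle_mono by blast
    qed
    then have "bounded (range (\<Psi> v))" by (auto simp: bounded_iff)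
    with c show ?thesis by (simp add: bcontfun_def)
  qed
  define G where "G v = Bcontfun (\<Psi> (apply_bcontfun v))" for v :: "real \<Rightarrow>\<^sub>C 'a"
  have G: "apply_bcontfun (G v) = \<Psi> (apply_bcontfun v)" for v
    unfolding G_def by (intro Bcontfun_inverse \<Psi>) auto
  have "dist (G v) (G w) \<le> 1/2 * dist v w" for v w
  proof (rule dist_bound)
    fix t
    have "norm (h (apply_bcontfun v) s - h (apply_bcontfun w) s) \<le> (K * dist v w) * exp (M * s)" for s
    proof -
      have "norm (h (apply_bcontfun v) s - h (apply_bcontfun w) s)
          \<le> K * norm (exp (M * s) *\<^sub>R (apply_bcontfun v s - apply_bcontfun w s))"
        unfolding h_def scaleR_right_diff_distrib by (rule Lip)
      also have "\<dots> \<le> K * (exp (M * s) * dist v w)"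
        using KL dist_bounded[of v s w] by (intro mult_left_mono) (auto simp: dist_norm)
      finally show ?thesis by (simp add: algebra_simps)
    qed
    then have "norm (exp (- M * max 0 t) *\<^sub>R integral {0..max 0 t}
          (\<lambda>s. h (apply_bcontfun v) s - h (apply_bcontfun w) s)) \<le> K * dist v w / M"
      using M0 by (intro norm_integral_le_exp continuous_intros hcont) auto
    also have "integral {0..max 0 t} (\<lambda>s. h (apply_bcontfun v) s - h (apply_bcontfun w) s)
       = J (apply_bcontfun v) (max 0 t) - J (apply_bcontfun w) (max 0 t)"
      unfolding J_def by (intro integral_diff integrable_continuous_interval hcont) auto
    also have "K * dist v w / M = 1/2 * dist v w" using KL by (simp add: M_def)
    finally show "dist (apply_bcontfun (G v) t) (apply_bcontfun (G w) t) \<le> 1/2 * dist v w"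
      unfolding G \<Psi>_def dist_norm by (simp add: scaleR_right_diff_distrib algebra_simps)
  qed
  then obtain v where "G v = v"
    using banach_fix_type[of "1/2" G] by auto
  then have v: "apply_bcontfun v t = \<Psi> (apply_bcontfun v) t" for t
    using G by metis
  \<comment> \<open>For \<open>t >= 0\<close> this is \<open>exp (M * t) *\<^sub>R v t\<close>, so
    undoing the weight turns the fixed point equation into the integral equation for
    \<open>u\<close>.\<close>
  define u where "u t = x0 + J (apply_bcontfun v) t" for t
  have u: "F (u t) = h (apply_bcontfun v) t" if "t \<ge> 0" for t
    unfolding h_def v[of t] using that by (simp add: \<Psi>_def u_def exp_minus)
  show ?thesis
  proof
    show "u 0 = x0" by (simp add: u_def J_def)
    show "(u has_vector_derivative F (u t)) (at t within {0..})" if "t \<ge> 0" for t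
      unfolding u[OF that] unfolding u_def[abs_def]
      using Jderiv[of "apply_bcontfun v" t] that by (auto intro!: derivative_eq_intros)
  qed
qed

section \<open>Energy estimates for the truncated system\<close>

lemma sum_shift_down:
  fixes g :: "nat \<Rightarrow> real"
  assumes "g 0 = 0" and "g n = 0"
  shows "(\<Sum>k=1..n. g (k - 1)) = (\<Sum>k=1..n. g k)"
proof -
  have "(\<Sum>k=1..n. g (k - 1)) + g n = g 0 + (\<Sum>k=1..n. g k)"
    by (induction n) auto
  then show ?thesis using assms by simp
qed

text \<open>The gain of mode \<open>k\<close> and the loss of mode \<open>k + 1\<close> are the same
  cubic flux \<open>h k\<close>, weighted by \<open>c ^ k\<close> and \<open>c ^ (k + 1)\<close>.
  After an index shift without boundary terms only the factor \<open>1 - c\<close> is left, and for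
  \<open>c = 1\<close> the energy is conserved.\<close>

lemma weighted_energy_balance:
  fixes a c :: real
  assumes "z 0 = 0" and "z (n + 1) = 0"
  shows "(\<Sum>k=1..n. c ^ k * (2 * z k * (a ^ k * (z (k + 1))\<^sup>2 - a ^ (k - 1) * z (k - 1) * z k)))
    = - (2 * (c - 1) * (\<Sum>k=1..n. (c * a) ^ k * (z k * (z (k + 1))\<^sup>2)))"
proof -
  define h where "h k = (c * a) ^ k * (z k * (z (k + 1))\<^sup>2)" for k
  have "(\<Sum>k=1..n. c ^ k * (2 * z k * (a ^ k * (z (k + 1))\<^sup>2 - a ^ (k - 1) * z (k - 1) * z k)))
      = (\<Sum>k=1..n. 2 * h k - 2 * c * h (k - 1))"
  proof (rule sum.cong)
    fix k assume "k \<in> {1..n}"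
    then obtain j where "k = Suc j" by (cases k) auto
    then show "c ^ k * (2 * z k * (a ^ k * (z (k + 1))\<^sup>2 - a ^ (k - 1) * z (k - 1) * z k))
      = 2 * h k - 2 * c * h (k - 1)"
      unfolding h_def power_mult_distrib by (simp add: power2_eq_square algebra_simps)
  qed auto
  also have "\<dots> = 2 * (\<Sum>k=1..n. h k) - 2 * c * (\<Sum>k=1..n. h (k - 1))"
    by (simp add: sum_subtractf sum_distrib_left)
  also have "(\<Sum>k=1..n. h (k - 1)) = (\<Sum>k=1..n. h k)"
    by (rule sum_shift_down) (use assms in \<open>auto simp: h_def\<close>)
  finally show ?thesis unfolding h_def by (simp add: algebra_simps)
qed

lemma increment_ge_of_derivative_ge:
  fixes f f' :: "real \<Rightarrow> real"
  assumes "s \<le> t"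
    and "\<And>u. s \<le> u \<Longrightarrow> u \<le> t \<Longrightarrow> (f has_real_derivative f' u) (at u within {s..t})"
    and "\<And>u. s < u \<Longrightarrow> u < t \<Longrightarrow> m \<le> f' u"
  shows "m * (t - s) \<le> f t - f s"
proof (cases "s = t")
  case False
  with \<open>s \<le> t\<close> have "s < t" by simp
  then obtain u where "u \<in> {s<..<t}" "f t - f s = f' u * (t - s)"
    using mvt_simple[of s t f "\<lambda>u. (*) (f' u)"] assms(2)
    by (auto simp: has_field_derivative_def)
  with assms(3)[of u] \<open>s < t\<close> show ?thesis by (auto intro!: mult_right_mono)
qed auto

section \<open>Elementary inequalities\<close>

lemma mult_le_complete_square:
  fixes b z m :: real
  assumes "m > 0"
  shows "b * z \<le> m * z\<^sup>2 + b\<^sup>2 / (4 * m)"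
proof -
  have "4 * m * (b * z) \<le> 4 * m * (m * z\<^sup>2) + b\<^sup>2"
    using zero_le_power2[of "2 * m * z - b"] by (simp add: power2_eq_square algebra_simps)
  also have "\<dots> = 4 * m * (m * z\<^sup>2 + b\<^sup>2 / (4 * m))"
    using assms by (simp add: distrib_left)
  finally show ?thesis using assms by simp
qed

text \<open>Completing the square in \<open>z\<close> leaves a term linear in \<open>y\<close>, and
  completing the square in \<open>y\<close> leaves a constant. The quadratic cross term is thus
  split into a flux part \<open>y * z\<^sup>2\<close>, an energy part \<open>y\<^sup>2\<close> and a
  remainder.\<close>

lemma bootstrap_inequality:
  fixes b z y \<mu> \<epsilon> :: real
  assumes "\<mu> > 0" "\<epsilon> > 0" "y \<ge> 0"
  shows "b * (y * z) \<le> \<mu> * (y * z\<^sup>2) + \<epsilon> * y\<^sup>2 + b ^ 4 / (64 * \<epsilon> * \<mu>\<^sup>2)"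
proof -
  define r where "r = b\<^sup>2 / (4 * \<mu>)"
  have "y * (b * z) \<le> y * (\<mu> * z\<^sup>2 + r)"
    using assms mult_le_complete_square[of \<mu> b z] by (intro mult_left_mono) (auto simp: r_def)
  moreover have "r * y \<le> \<epsilon> * y\<^sup>2 + r\<^sup>2 / (4 * \<epsilon>)"
    by (rule mult_le_complete_square) fact
  moreover have "r\<^sup>2 / (4 * \<epsilon>) = b ^ 4 / (64 * \<epsilon> * \<mu>\<^sup>2)"
    unfolding r_def by (simp add: power_divide power_mult_distrib power_mult[symmetric] mult_ac)
  ultimately show ?thesis by (simp add: algebra_simps)
qed

lemma sum_power_le:
  fixes r :: real
  assumes "0 \<le> r" "r < 1"
  shows "(\<Sum>k=1..n. r ^ k) \<le> 1 / (1 - r)"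
proof -
  have "(\<Sum>k=1..n. r ^ k) \<le> (\<Sum>k. r ^ k)"
    using assms by (intro sum_le_suminf summable_geometric) auto
  then show ?thesis using assms suminf_geometric[of r] by simp
qed

text \<open>The equation is demanded for every \<open>k >= 1\<close>, also beyond \<open>n\<close>:
  a mode receives energy only from the mode above it, so vanishing modes above \<open>n\<close>
  solve their equations whatever the lower modes do. The truncation is therefore an exact solution
  and creates no error term.\<close>

locale galerkin =
  fixes a :: real and n :: nat and x :: "real \<Rightarrow> nat \<Rightarrow> real"
  assumes a_gt_1: "a > 1"
    and nonneg: "t \<ge> 0 \<Longrightarrow> x t k \<ge> 0"
    and vanishes: "t \<ge> 0 \<Longrightarrow> k = 0 \<or> k > n \<Longrightarrow> x t k = 0"
    and deriv: "t \<ge> 0 \<Longrightarrow> k \<ge> 1 \<Longrightarrow> ((\<lambda>u. x u k) has_real_derivative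
      a ^ k * (x t (k + 1))\<^sup>2 - a ^ (k - 1) * x t (k - 1) * x t k) (at t within {0..})"
    and initial_energy: "(\<Sum>k=1..n. (x 0 k)\<^sup>2) = 1"
begin

definition energy :: "real \<Rightarrow> real \<Rightarrow> real" where
  "energy c t = (\<Sum>k=1..n. c ^ k * (x t k)\<^sup>2)"

definition flux :: "real \<Rightarrow> real \<Rightarrow> real" where
  "flux c t = (\<Sum>k=1..n. (c * a) ^ k * (x t k * (x t (k + 1))\<^sup>2))"

lemma flux_nonneg: "c \<ge> 0 \<Longrightarrow> t \<ge> 0 \<Longrightarrow> flux c t \<ge> 0"
  unfolding flux_def using nonneg a_gt_1 by (intro sum_nonneg mult_nonneg_nonneg zero_le_power) auto

lemma energy_nonneg: "c \<ge> 0 \<Longrightarrow> energy c t \<ge> 0"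
  unfolding energy_def by (intro sum_nonneg) auto

lemma energy_mono: "0 \<le> c \<Longrightarrow> c \<le> d \<Longrightarrow> energy c t \<le> energy d t"
  unfolding energy_def by (intro sum_mono mult_right_mono power_mono) auto

lemma energy_has_derivative:
  assumes t: "t \<ge> 0"
  shows "(energy c has_real_derivative - (2 * (c - 1) * flux c t)) (at t within {0..})"
proof -
  have "((\<lambda>u. c ^ k * (x u k)\<^sup>2) has_real_derivative
      c ^ k * (2 * x t k * (a ^ k * (x t (k + 1))\<^sup>2 - a ^ (k - 1) * x t (k - 1) * x t k)))
      (at t within {0..})" if "k \<in> {1..n}" for k
    using that by (auto intro!: derivative_eq_intros deriv[OF t])
  then have "(energy c has_real_derivative
      (\<Sum>k=1..n. c ^ k * (2 * x t k * (a ^ k * (x t (k + 1))\<^sup>2 - a ^ (k - 1) * x t (k - 1) * x t k))))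
      (at t within {0..})"
    unfolding energy_def[abs_def] by (intro DERIV_sum) auto
  then show ?thesis
    unfolding flux_def by (subst (asm) weighted_energy_balance) (auto simp: vanishes[OF t])
qed

lemma energy_antimono:
  assumes "c \<ge> 1" and "0 \<le> s" and "s \<le> t"
  shows "energy c t \<le> energy c s"
proof -
  have "0 * (t - s) \<le> - energy c t - - energy c s"
  proof (rule increment_ge_of_derivative_ge[OF \<open>s \<le> t\<close>])
    show "((\<lambda>u. - energy c u) has_real_derivative 2 * (c - 1) * flux c u) (at u within {s..t})"
      if "s \<le> u" "u \<le> t" for u
      using that assms
      by (auto intro!: derivative_eq_intros DERIV_subset[OF energy_has_derivative])
    show "0 \<le> 2 * (c - 1) * flux c u" if "s < u" "u < t" for u
      using assms that flux_nonneg[of c u] by simp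
  qed
  then show ?thesis by simp
qed

lemma energy_conserved:
  assumes "t \<ge> 0"
  shows "energy 1 t = 1"
proof -
  have "(energy 1 has_real_derivative 0) (at u within {0..})" if "u \<ge> 0" for u
    using energy_has_derivative[OF that, of 1] by simp
  then have "\<exists>C. \<forall>u\<in>{0..}. energy 1 u = C"
    by (intro has_field_derivative_zero_constant) auto
  then have "energy 1 t = energy 1 0" using assms by auto
  then show ?thesis using initial_energy by (simp add: energy_def)
qed

lemma le_energy:
  assumes "c \<ge> 0" "t \<ge> 0"
  shows "c ^ k * (x t k)\<^sup>2 \<le> energy c t"
proof (cases "k \<in> {1..n}")
  case True
  then show ?thesis
    unfolding energy_def using assms
    by (intro member_le_sum[of k _ "\<lambda>k. c ^ k * (x t k)\<^sup>2"]) auto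
next
  case False
  then have "x t k = 0" using vanishes[OF assms(2), of k] by auto
  then show ?thesis using energy_nonneg[OF assms(1)] by simp
qed

lemma le_1:
  assumes "t \<ge> 0"
  shows "x t k \<le> 1"
  using le_energy[of 1 t k] energy_conserved[OF assms] assms
  by (simp add: abs_square_le_1)

text \<open>With \<open>b = d / a\<close> the quadratic gain term is, up to a factor
  \<open>d\<close> and the first mode, the energy of weight \<open>d\<close>. The loss term is the
  cross term that \<open>bootstrap_inequality\<close> absorbs.\<close>

lemma momentum_has_derivative:
  assumes t: "t \<ge> 0" and d: "d = b * a"
  shows "((\<lambda>u. \<Sum>k=1..n. b ^ k * x u k) has_real_derivative
    (\<Sum>k=1..n. d ^ k * (x t (k + 1))\<^sup>2) - (\<Sum>k=1..n. d ^ k * (b * (x t k * x t (k + 1)))))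
    (at t within {0..})"
proof -
  define g where "g k = d ^ k * (b * (x t k * x t (k + 1)))" for k
  have "((\<lambda>u. b ^ k * x u k) has_real_derivative
      b ^ k * (a ^ k * (x t (k + 1))\<^sup>2 - a ^ (k - 1) * x t (k - 1) * x t k)) (at t within {0..})"
    if "k \<in> {1..n}" for k
    using that by (auto intro!: derivative_eq_intros deriv[OF t])
  then have "((\<lambda>u. \<Sum>k=1..n. b ^ k * x u k) has_real_derivative
      (\<Sum>k=1..n. b ^ k * (a ^ k * (x t (k + 1))\<^sup>2 - a ^ (k - 1) * x t (k - 1) * x t k)))
      (at t within {0..})"
    by (intro DERIV_sum) auto
  also have "(\<Sum>k=1..n. b ^ k * (a ^ k * (x t (k + 1))\<^sup>2 - a ^ (k - 1) * x t (k - 1) * x t k))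
      = (\<Sum>k=1..n. d ^ k * (x t (k + 1))\<^sup>2 - g (k - 1))"
  proof (rule sum.cong)
    fix k assume "k \<in> {1..n}"
    then obtain j where "k = Suc j" by (cases k) auto
    then show "b ^ k * (a ^ k * (x t (k + 1))\<^sup>2 - a ^ (k - 1) * x t (k - 1) * x t k)
      = d ^ k * (x t (k + 1))\<^sup>2 - g (k - 1)"
      unfolding g_def d power_mult_distrib by (simp add: algebra_simps)
  qed auto
  also have "\<dots> = (\<Sum>k=1..n. d ^ k * (x t (k + 1))\<^sup>2) - (\<Sum>k=1..n. g (k - 1))"
    by (simp add: sum_subtractf)
  also have "(\<Sum>k=1..n. g (k - 1)) = (\<Sum>k=1..n. g k)"
    by (rule sum_shift_down) (auto simp: g_def vanishes[OF t])
  finally show ?thesis unfolding g_def .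
qed

text \<open>The energy of weight \<open>d\<close> is non-increasing, so a bound for its time integral bounds its final
  value. The time integral is controlled by the growth of the linear functional
  \<open>\<Sum>k. (d / a) ^ k * x k\<close>, up to the flux of weight \<open>c\<close>, which is an exact time derivative.\<close>

lemma energy_bootstrap:
  assumes c: "c > 0" "c \<noteq> 1" and d: "d > 1" "d ^ 3 < (c * a)\<^sup>2" "d\<^sup>2 < c * a\<^sup>2"
    and s: "0 \<le> s" "s < t" and B: "\<And>u. u \<in> {s..t} \<Longrightarrow> energy c u \<le> B"
  shows "energy d t \<le> 2 * d * (1 + (d / a) ^ 4 * d / 32 / (1 - d ^ 3 / (c * a)\<^sup>2)
    + (B + 1 / (1 - (d / a)\<^sup>2 / c) + B / (2 * \<bar>c - 1\<bar>)) / (t - s))"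
proof -
  define b where "b = d / a"
  define \<rho> where "\<rho> = d ^ 3 / (c * a)\<^sup>2"
  define S where "S = b ^ 4 * d / 32 / (1 - \<rho>)"
  define P where "P u = (\<Sum>k=1..n. b ^ k * x u k)" for u
  define DP where "DP u = (\<Sum>k=1..n. d ^ k * (x u (k + 1))\<^sup>2)
      - (\<Sum>k=1..n. d ^ k * (b * (x u k * x u (k + 1))))" for u
  have a0: "a > 0" and b0: "b > 0" and d0: "d > 0" using a_gt_1 d by (auto simp: b_def)
  have dba: "d = b * a" using a0 by (simp add: b_def)
  have \<rho>: "0 \<le> \<rho>" "\<rho> < 1" using c a0 d by (auto simp: \<rho>_def)
  have DP: "energy d u / (2 * d) - 1 - S - flux c u \<le> DP u" if u: "u \<ge> 0" for u
  proof -
    \<comment> \<open>The shifted sum misses only the first mode,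
      \<open>h 1 = (x u 1)\<^sup>2\<close>, which is the source of the constant 1.\<close>
    define h where "h k = d ^ k * (x u k)\<^sup>2 / d" for k
    have "(\<Sum>k=1..m. h (k + 1)) + h 1 = (\<Sum>k=1..m. h k) + h (m + 1)" for m
      by (induction m) auto
    from this[of n] have "(\<Sum>k=1..n. h (k + 1)) = (\<Sum>k=1..n. h k) - h 1"
      by (simp add: h_def vanishes[OF u])
    moreover have "h 1 \<le> 1"
      using le_1[OF u, of 1] nonneg[OF u, of 1] d0 by (simp add: h_def abs_square_le_1)
    ultimately have 1: "(\<Sum>k=1..n. d ^ k * (x u (k + 1))\<^sup>2) \<ge> energy d u / d - 1"
      using d0 by (simp add: h_def energy_def sum_divide_distrib)
    have "(\<Sum>k=1..n. d ^ k * (b * (x u k * x u (k + 1)))) \<le>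
        (\<Sum>k=1..n. (c * a) ^ k * (x u k * (x u (k + 1))\<^sup>2) + d ^ k * (x u k)\<^sup>2 / (2 * d)
          + b ^ 4 * d / 32 * \<rho> ^ k)"
    proof (rule sum_mono)
      fix k
      \<comment> \<open>This choice makes \<open>d ^ k * \<mu>\<close> the flux weight
        \<open>(c * a) ^ k\<close>. The remainder is then geometric with ratio
        \<open>\<rho>\<close>, which is below 1 exactly by \<open>d ^ 3 < (c * a)\<^sup>2\<close>.
        Young's second parameter \<open>1 / (2 * d)\<close> spends half of the energy
        gained.\<close>
      define \<mu> where "\<mu> = (c * a / d) ^ k"
      have \<mu>: "\<mu> > 0" using c a0 d0 by (simp add: \<mu>_def)
      have "d ^ k * (b * (x u k * x u (k + 1))) \<le>
        d ^ k * (\<mu> * (x u k * (x u (k + 1))\<^sup>2) + (1 / (2 * d)) * (x u k)\<^sup>2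
          + b ^ 4 / (64 * (1 / (2 * d)) * \<mu>\<^sup>2))"
        using \<mu> d0 nonneg[OF u] by (intro mult_left_mono bootstrap_inequality) auto
      also have "\<dots> = (d ^ k * \<mu>) * (x u k * (x u (k + 1))\<^sup>2) + d ^ k * (x u k)\<^sup>2 / (2 * d)
          + b ^ 4 * d / 32 * (d ^ k / \<mu>\<^sup>2)"
        using d0 by (simp add: distrib_left)
      also have "d ^ k * \<mu> = (c * a) ^ k"
        using d0 by (simp add: \<mu>_def power_mult_distrib[symmetric])
      also have "d ^ k / \<mu>\<^sup>2 = (d / (c * a / d)\<^sup>2) ^ k"
      proof -
        have "\<mu>\<^sup>2 = ((c * a / d)\<^sup>2) ^ k"
          unfolding \<mu>_def power_mult[symmetric] by (simp only: mult.commute)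
        then show ?thesis by (simp only: power_divide[of d])
      qed
      also have "d / (c * a / d)\<^sup>2 = \<rho>"
        using d0 by (simp add: \<rho>_def power_divide power3_eq_cube power2_eq_square)
      finally show "d ^ k * (b * (x u k * x u (k + 1))) \<le>
        (c * a) ^ k * (x u k * (x u (k + 1))\<^sup>2) + d ^ k * (x u k)\<^sup>2 / (2 * d)
          + b ^ 4 * d / 32 * \<rho> ^ k" .
    qed
    also have "\<dots> = flux c u + energy d u / (2 * d) + b ^ 4 * d / 32 * (\<Sum>k=1..n. \<rho> ^ k)"
      by (simp add: sum.distrib flux_def energy_def sum_divide_distrib sum_distrib_left)
    also have "b ^ 4 * d / 32 * (\<Sum>k=1..n. \<rho> ^ k) \<le> b ^ 4 * d / 32 * (1 / (1 - \<rho>))"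
      using b0 d0 \<rho> by (intro mult_left_mono sum_power_le) auto
    also have "\<dots> = S" by (simp add: S_def)
    finally show ?thesis using 1 unfolding DP_def by (simp add: field_simps)
  qed
  \<comment> \<open>Dividing the energy of weight \<open>c\<close> by \<open>2 * (c - 1)\<close>
    produces the flux with the right sign on either side of 1, so that it cancels the flux in
    \<open>DP\<close>. Monotonicity replaces \<open>energy d u\<close> by the final value.\<close>
  have "(energy d t / (2 * d) - 1 - S) * (t - s)
      \<le> (P t - energy c t / (2 * (c - 1))) - (P s - energy c s / (2 * (c - 1)))"
  proof (rule increment_ge_of_derivative_ge)
    show "((\<lambda>u. P u - energy c u / (2 * (c - 1))) has_real_derivative DP u + flux c u)
        (at u within {s..t})" if u: "s \<le> u" "u \<le> t" for u
    proof -
      have "(P has_real_derivative DP u) (at u within {s..t})"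
        unfolding P_def[abs_def] DP_def
        by (rule DERIV_subset[OF momentum_has_derivative[OF _ dba]]) (use u s in auto)
      moreover have "(energy c has_real_derivative - (2 * (c - 1) * flux c u)) (at u within {s..t})"
        by (rule DERIV_subset[OF energy_has_derivative]) (use u s in auto)
      ultimately show ?thesis using c by (auto intro!: derivative_eq_intros)
    qed
    show "energy d t / (2 * d) - 1 - S \<le> DP u + flux c u" if u: "s < u" "u < t" for u
    proof -
      have "energy d t / (2 * d) \<le> energy d u / (2 * d)"
        using u s d d0 by (intro divide_right_mono energy_antimono) auto
      then show ?thesis using DP[of u] u s by simp
    qed
  qed (use s in auto)
  moreover have "P s \<ge> 0" unfolding P_def using nonneg b0 s by (auto intro!: sum_nonneg)
  \<comment> \<open>Squares are completed with parameter \<open>c ^ k\<close>; the remainder has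
    ratio \<open>b\<^sup>2 / c < 1\<close> because \<open>d\<^sup>2 < c * a\<^sup>2\<close>.\<close>
  moreover have "P t \<le> B + 1 / (1 - b\<^sup>2 / c)"
  proof -
    have "P t \<le> (\<Sum>k=1..n. c ^ k * (x t k)\<^sup>2 + (b\<^sup>2 / c) ^ k)"
      unfolding P_def
    proof (rule sum_mono)
      fix k
      have "b ^ k * x t k \<le> c ^ k * (x t k)\<^sup>2 + (b ^ k)\<^sup>2 / (4 * c ^ k)"
        using c by (intro mult_le_complete_square) auto
      also have "(b ^ k)\<^sup>2 / (4 * c ^ k) = (b\<^sup>2 / c) ^ k / 4"
        by (simp add: power_divide power_mult[symmetric] mult.commute)
      also have "\<dots> \<le> (b\<^sup>2 / c) ^ k" using c by simp
      finally show "b ^ k * x t k \<le> c ^ k * (x t k)\<^sup>2 + (b\<^sup>2 / c) ^ k" by simp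
    qed
    also have "\<dots> = energy c t + (\<Sum>k=1..n. (b\<^sup>2 / c) ^ k)"
      by (simp add: sum.distrib energy_def)
    also have "\<dots> \<le> B + 1 / (1 - b\<^sup>2 / c)"
      using B[of t] s c a0 d by (intro add_mono sum_power_le) (auto simp: b_def field_simps)
    finally show ?thesis .
  qed
  moreover have "energy c s / (2 * (c - 1)) - energy c t / (2 * (c - 1)) \<le> B / (2 * \<bar>c - 1\<bar>)"
  proof -
    have "0 \<le> energy c s" "0 \<le> energy c t" "energy c s \<le> B" "energy c t \<le> B"
      using B s c energy_nonneg by auto
    then have le: "\<bar>energy c s - energy c t\<bar> \<le> B" by auto
    have "energy c s / (2 * (c - 1)) - energy c t / (2 * (c - 1))
        = (energy c s - energy c t) / (2 * (c - 1))" by (rule diff_divide_distrib[symmetric])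
    also have "\<dots> \<le> \<bar>energy c s - energy c t\<bar> / \<bar>2 * (c - 1)\<bar>"
      unfolding abs_divide[symmetric] by (rule abs_ge_self)
    also have "\<bar>2 * (c - 1)\<bar> = 2 * \<bar>c - 1\<bar>" by (simp add: abs_if)
    also have "\<bar>energy c s - energy c t\<bar> / (2 * \<bar>c - 1\<bar>) \<le> B / (2 * \<bar>c - 1\<bar>)"
      using le by (intro divide_right_mono) auto
    finally show ?thesis .
  qed
  ultimately have "(energy d t / (2 * d) - 1 - S) * (t - s)
      \<le> B + 1 / (1 - b\<^sup>2 / c) + B / (2 * \<bar>c - 1\<bar>)" by simp
  then have "energy d t / (2 * d) - 1 - S
      \<le> (B + 1 / (1 - b\<^sup>2 / c) + B / (2 * \<bar>c - 1\<bar>)) / (t - s)"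
    using s by (simp add: pos_le_divide_eq)
  then have "energy d t / (2 * d) \<le> 1 + S + (B + 1 / (1 - b\<^sup>2 / c) + B / (2 * \<bar>c - 1\<bar>)) / (t - s)"
    by simp
  then have "energy d t \<le> 2 * d * (1 + S + (B + 1 / (1 - b\<^sup>2 / c) + B / (2 * \<bar>c - 1\<bar>)) / (t - s))"
    using d0 by (simp add: pos_divide_le_eq mult.commute)
  then show ?thesis unfolding S_def \<rho>_def b_def .
qed

end

text \<open>The weights climb through \<open>1 / p\<close>, \<open>p\<close>, \<open>p ^ 3\<close>
  and so on. For \<open>d = p\<^sup>2 * c\<close> the condition
  \<open>d ^ 3 < (c * a)\<^sup>2\<close> reads \<open>p ^ 6 * c < a\<^sup>2\<close>, which holds up
  to \<open>c = C\<close>. Each stage halves \<open>\<tau>\<close>, so the induction is over all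
  \<open>\<tau>\<close> at once.\<close>

lemma galerkin_energy_bounded:
  fixes a C \<tau> :: real
  assumes C: "1 < C" "C < a\<^sup>2" and "a > 1" and "\<tau> > 0"
  shows "\<exists>B. \<forall>n x t. galerkin a n x \<longrightarrow> t \<ge> \<tau> \<longrightarrow> galerkin.energy n x C t \<le> B"
proof -
  \<comment> \<open>The exponent makes \<open>p ^ 6\<close> the square root of
    \<open>a\<^sup>2 / C\<close>, hence strictly smaller than it.\<close>
  define p where "p = (a\<^sup>2 / C) powr (1/12)"
  have aC: "a\<^sup>2 / C > 1" using C by simp
  have p1: "p > 1" unfolding p_def using aC by simp
  have "p ^ 6 = (a\<^sup>2 / C) powr (1/2)"
    unfolding p_def using aC by (simp add: powr_powr flip: powr_numeral)
  also have "\<dots> < a\<^sup>2 / C" using powr_less_mono[of "1/2" 1 "a\<^sup>2 / C"] aC by simp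
  finally have p6: "p ^ 6 * C < a\<^sup>2" using C by (simp add: field_simps)
  text \<open>The odd powers of \<open>p\<close> avoid the weight \<open>1\<close>, at which the energy carries no information
    on the flux.\<close>
  have step: "\<forall>\<tau>>0. \<exists>B. \<forall>n x t. galerkin a n x \<longrightarrow> t \<ge> \<tau> \<longrightarrow>
      galerkin.energy n x (p ^ (2 * j) / p) t \<le> B" if "p ^ (2 * j) / p \<le> p\<^sup>2 * C" for j
    using that
  proof (induction j)
    case 0
    have "galerkin.energy n x (1 / p) t \<le> 1" if g: "galerkin a n x" "t \<ge> 0" for n x t
    proof -
      interpret galerkin a n x by fact
      show ?thesis using energy_mono[of "1/p" 1 t] energy_conserved[OF that(2)] p1 by simp
    qed
    then show ?case by (fastforce intro: exI[of _ 1])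
  next
    case (Suc j)
    define c where "c = p ^ (2 * j) / p"
    define d where "d = p ^ (2 * Suc j) / p"
    have dc: "d = p\<^sup>2 * c" by (simp add: d_def c_def power2_eq_square)
    have c0: "c > 0" using p1 by (simp add: c_def)
    have "p\<^sup>2 * c \<le> p\<^sup>2 * C" using Suc.prems[folded d_def] unfolding dc .
    then have cC: "c \<le> C" using p1 by simp
    have "1 * C \<le> p\<^sup>2 * C" using p1 C by (intro mult_right_mono one_le_power) auto
    with cC have "c \<le> p\<^sup>2 * C" by simp
    note IH = Suc.IH[folded c_def, OF this]
    have c1: "c \<noteq> 1"
    proof
      assume "c = 1"
      then have "p ^ (2 * j) = p ^ 1" using p1 by (simp add: c_def)
      then have "2 * j = 1" using p1 by (subst (asm) power_inject_exp) auto
      then show False by presburger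
    qed
    have d1: "d > 1"
    proof -
      have "p ^ (2 * Suc j) > p ^ 1" using p1 by (intro power_strict_increasing) auto
      then show ?thesis using p1 by (simp add: d_def)
    qed
    have p6c: "p ^ 6 * c < a\<^sup>2"
    proof -
      have "p ^ 6 * c \<le> p ^ 6 * C" using cC p1 by (intro mult_left_mono) auto
      then show ?thesis using p6 by (rule order.strict_trans1)
    qed
    have d3: "d ^ 3 < (c * a)\<^sup>2"
    proof -
      have "d ^ 3 = c\<^sup>2 * (p ^ 6 * c)" unfolding dc by (simp add: power_mult_distrib power2_eq_square power3_eq_cube eval_nat_numeral)
      also have "\<dots> < c\<^sup>2 * a\<^sup>2" using p6c c0 by (intro mult_strict_left_mono) auto
      finally show ?thesis by (simp add: power_mult_distrib)
    qed
    have d2: "d\<^sup>2 < c * a\<^sup>2"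
    proof -
      have "d\<^sup>2 = c * (p ^ 4 * c)" unfolding dc by (simp add: power_mult_distrib power2_eq_square eval_nat_numeral)
      also have "\<dots> \<le> c * (p ^ 6 * c)"
        using c0 p1 by (intro mult_left_mono mult_right_mono power_increasing) auto
      also have "\<dots> < c * a\<^sup>2" using p6c c0 by (intro mult_strict_left_mono) auto
      finally show ?thesis .
    qed
    show ?case
      unfolding d_def[symmetric]
    proof (intro allI impI)
      fix \<tau> :: real assume \<tau>: "\<tau> > 0"
      then obtain B where B: "galerkin.energy n x c t \<le> B" if "galerkin a n x" "t \<ge> \<tau> / 2" for n x t
        using IH[rule_format, of "\<tau> / 2"] by auto
      \<comment> \<open>The window from \<open>t - \<tau> / 2\<close> to \<open>t\<close> has fixed
        length and lies after \<open>\<tau> / 2\<close>, so the right-hand side depends on neither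
        \<open>n\<close> nor \<open>t\<close>.\<close>
      have "galerkin.energy n x d t \<le> 2 * d * (1 + (d / a) ^ 4 * d / 32 / (1 - d ^ 3 / (c * a)\<^sup>2)
          + (B + 1 / (1 - (d / a)\<^sup>2 / c) + B / (2 * \<bar>c - 1\<bar>)) / (t - (t - \<tau> / 2)))"
        if "galerkin a n x" "t \<ge> \<tau>" for n x t
        using that \<tau> B[OF that(1)]
        by (intro galerkin.energy_bootstrap c0 c1 d1 d2 d3) auto
      then show "\<exists>B. \<forall>n x t. galerkin a n x \<longrightarrow> t \<ge> \<tau> \<longrightarrow> galerkin.energy n x d t \<le> B"
        by fastforce
    qed
  qed
  obtain m where "C * p < p ^ m" using real_arch_pow[OF p1] by blast
  also have "p ^ m \<le> p ^ (2 * m)" using p1 by (intro power_increasing) auto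
  finally have ex: "\<exists>m. C \<le> p ^ (2 * m) / p" using p1 by (auto simp: field_simps intro!: exI[of _ m])
  \<comment> \<open>The first weight that reaches \<open>C\<close> exceeds it by at most one factor
    \<open>p\<^sup>2\<close>, which keeps it within the range of \<open>step\<close>.\<close>
  define j where "j = (LEAST m. C \<le> p ^ (2 * m) / p)"
  have j: "C \<le> p ^ (2 * j) / p" unfolding j_def by (rule LeastI_ex[OF ex])
  have "j \<noteq> 0"
  proof
    assume "j = 0"
    with j have "C \<le> 1 / p" by simp
    also have "\<dots> < 1" using p1 by simp
    finally show False using C by simp
  qed
  then obtain i where i: "j = Suc i" by (cases j) auto
  then have "\<not> C \<le> p ^ (2 * i) / p" using not_less_Least[of i "\<lambda>m. C \<le> p ^ (2 * m) / p"] by (simp add: j_def)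
  then have "p\<^sup>2 * (p ^ (2 * i) / p) \<le> p\<^sup>2 * C" using p1 by (intro mult_left_mono) auto
  then have "p ^ (2 * j) / p \<le> p\<^sup>2 * C" unfolding i by (simp add: power2_eq_square)
  from step[OF this] \<open>\<tau> > 0\<close> obtain B
    where B: "galerkin.energy n x (p ^ (2 * j) / p) t \<le> B" if "galerkin a n x" "t \<ge> \<tau>" for n x t
    by blast
  have "galerkin.energy n x C t \<le> B" if "galerkin a n x" "t \<ge> \<tau>" for n x t
  proof -
    interpret galerkin a n x by fact
    show ?thesis using energy_mono[OF _ j, of t] C B[OF that] by simp
  qed
  then show ?thesis by blast
qed

section \<open>Existence for the truncated system\<close>

text \<open>After the last time \<open>s\<close> before \<open>t\<close> with
  \<open>f s >= 0\<close> the function is negative, hence non-decreasing, so \<open>f t\<close>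
  cannot fall below \<open>f s\<close>.\<close>

lemma nonneg_of_derivative_nonneg_below_zero:
  fixes f f' :: "real \<Rightarrow> real"
  assumes f: "\<And>t. t \<ge> 0 \<Longrightarrow> (f has_real_derivative f' t) (at t within {0..})"
    and f0: "f 0 \<ge> 0" and f': "\<And>t. t \<ge> 0 \<Longrightarrow> f t < 0 \<Longrightarrow> f' t \<ge> 0" and t: "t \<ge> 0"
  shows "f t \<ge> 0"
proof (rule ccontr)
  assume neg: "\<not> f t \<ge> 0"
  define S where "S = {0..t} \<inter> f -` {0..}"
  have "continuous_on {0..} f"
    by (rule DERIV_continuous_on[of _ _ f']) (use f in auto)
  then have "compact S"
    unfolding S_def
    by (intro compact_Int_closed[of "{0..t}" "{0..t} \<inter> f -` {0..}", simplified Int_left_absorb]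
        continuous_closed_preimage) (auto intro: continuous_on_subset)
  moreover have "0 \<in> S" using f0 t by (simp add: S_def)
  ultimately obtain s where s: "s \<in> S" "\<And>u. u \<in> S \<Longrightarrow> u \<le> s"
    using compact_attains_sup[of S] by blast
  have "0 * (t - s) \<le> f t - f s"
  proof (rule increment_ge_of_derivative_ge)
    show "s \<le> t" using s by (simp add: S_def)
    show "(f has_real_derivative f' u) (at u within {s..t})" if "s \<le> u" "u \<le> t" for u
      by (rule DERIV_subset[OF f]) (use that s in \<open>auto simp: S_def\<close>)
    show "0 \<le> f' u" if "s < u" "u < t" for u
      using f'[of u] s(2)[of u] s(1) that by (fastforce simp: S_def)
  qed
  then show False using s(1) neg by (simp add: S_def)
qed

text \<open>The library knows that \<open>bcontfun\<close> is complete only over a metric domain; this instance makes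
  \<open>nat \<Rightarrow>\<^sub>C real\<close>, the bounded sequences, a Banach space.\<close>

instantiation nat :: metric_space
begin

definition dist_nat :: "nat \<Rightarrow> nat \<Rightarrow> real" where
  "dist_nat m n = \<bar>real m - real n\<bar>"

definition uniformity_nat :: "(nat \<times> nat) filter" where
  "uniformity_nat = (INF e\<in>{0<..}. principal {(x, y). dist x y < e})"

instance
proof
  fix U :: "nat set"
  have eq: "m = n" if "\<bar>real m - real n\<bar> < 1" for m n
  proof -
    from that have "real m < real (n + 1)" "real n < real (m + 1)" by auto
    then show ?thesis unfolding of_nat_less_iff by simp
  qed
  have "\<forall>\<^sub>F (x', y) in uniformity. x' = x \<longrightarrow> y \<in> U" if "x \<in> U" for x
    unfolding uniformity_nat_def
    by (rule eventually_INF1[of 1]) (use that in \<open>auto simp: eventually_principal dist_nat_def dest: eq\<close>)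
  then show "open U \<longleftrightarrow> (\<forall>x\<in>U. \<forall>\<^sub>F (x', y) in uniformity. x' = x \<longrightarrow> y \<in> U)"
    by (simp add: open_discrete)
qed (auto simp: dist_nat_def uniformity_nat_def)

end

instance bcontfun :: (metric_space, banach) banach ..

lemma bounded_linear_apply_bcontfun:
  "bounded_linear (\<lambda>f :: 'a::topological_space \<Rightarrow>\<^sub>C 'b::real_normed_vector. apply_bcontfun f y)"
  by (rule bounded_linear_intro[of _ 1])
    (auto simp: plus_bcontfun.rep_eq scaleR_bcontfun.rep_eq norm_bounded)

text \<open>The cut at 0 switches off the loss term of a negative component. The cut at 2 lies above
  every component as long as the energy is below 2, although the initial energy is 1.\<close>

definition clamp02 :: "real \<Rightarrow> real" where
  "clamp02 y = max 0 (min y 2)"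

lemma clamp02: "0 \<le> clamp02 y" "clamp02 y \<le> 2" "\<bar>clamp02 y - clamp02 z\<bar> \<le> \<bar>y - z\<bar>"
  by (auto simp: clamp02_def)

text \<open>The clamp makes the vector field Lipschitz; conservation of energy shows that it never acts.\<close>

lemma galerkin_exists:
  fixes a :: real
  assumes a: "a > 1" and n: "n \<ge> 1"
  shows "\<exists>x. galerkin a n x \<and> (\<forall>k. k \<noteq> n \<longrightarrow> x 0 k = 0)"
proof -
  define f where "f z k = (if 1 \<le> k \<and> k \<le> n then a ^ k * (clamp02 (z (k + 1)))\<^sup>2
      - a ^ (k - 1) * clamp02 (z (k - 1)) * clamp02 (z k) else 0)" for z :: "nat \<Rightarrow> real" and k
  have supp: "g \<in> bcontfun" if "\<And>k. k > n \<Longrightarrow> g k = 0" for g :: "nat \<Rightarrow> real"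
  proof -
    have "g k \<in> insert 0 (g ` {..n})" for k using that[of k] by (cases "k \<le> n") auto
    then have "range g \<subseteq> insert 0 (g ` {..n})" by blast
    then have "bounded (range g)" using finite_imp_bounded finite_subset by blast
    then show ?thesis by (simp add: bcontfun_def continuous_on_discrete)
  qed
  define F where "F v = Bcontfun (f (apply_bcontfun v))" for v :: "nat \<Rightarrow>\<^sub>C real"
  have F: "apply_bcontfun (F v) = f (apply_bcontfun v)" for v
    unfolding F_def by (intro Bcontfun_inverse supp) (auto simp: f_def)
  have "dist (F v) (F w) \<le> (8 * a ^ n) * dist v w" for v w
  proof (rule dist_bound)
    fix k
    show "dist (apply_bcontfun (F v) k) (apply_bcontfun (F w) k) \<le> (8 * a ^ n) * dist v w"
    proof (cases "1 \<le> k \<and> k \<le> n")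
      case True
      define p where "p i = clamp02 (apply_bcontfun v i)" for i
      define q where "q i = clamp02 (apply_bcontfun w i)" for i
      have pq: "\<bar>p i - q i\<bar> \<le> dist v w" for i
        unfolding p_def q_def
        by (rule order_trans[OF clamp02(3) dist_bounded[of v i w, unfolded dist_real_def]])
      have bd: "0 \<le> p i" "p i \<le> 2" "0 \<le> q i" "q i \<le> 2" for i
        using clamp02 by (auto simp: p_def q_def)
      have pr: "\<bar>p i * p j - q i * q j\<bar> \<le> 4 * dist v w" for i j
      proof -
        have "p i * p j - q i * q j = p i * (p j - q j) + (p i - q i) * q j" by (simp add: algebra_simps)
        also have "\<bar>\<dots>\<bar> \<le> \<bar>p i\<bar> * \<bar>p j - q j\<bar> + \<bar>p i - q i\<bar> * \<bar>q j\<bar>"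
          unfolding abs_mult[symmetric] by (rule abs_triangle_ineq)
        also have "\<dots> \<le> 2 * dist v w + dist v w * 2"
          using pq bd by (intro add_mono mult_mono) auto
        finally show ?thesis by simp
      qed
      have le: "a ^ k \<le> a ^ n" "a ^ (k - 1) \<le> a ^ n" using True a by (auto intro!: power_increasing)
      have "f (apply_bcontfun v) k - f (apply_bcontfun w) k
        = a ^ k * (p (k+1) * p (k+1) - q (k+1) * q (k+1)) - a ^ (k - 1) * (p (k-1) * p k - q (k-1) * q k)"
        using True by (simp add: f_def p_def q_def power2_eq_square algebra_simps)
      also have "\<bar>\<dots>\<bar> \<le> \<bar>a ^ k\<bar> * \<bar>p (k+1) * p (k+1) - q (k+1) * q (k+1)\<bar>
          + \<bar>a ^ (k - 1)\<bar> * \<bar>p (k-1) * p k - q (k-1) * q k\<bar>"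
        unfolding abs_mult[symmetric] by (rule abs_triangle_ineq4)
      also have "\<dots> \<le> a ^ n * (4 * dist v w) + a ^ n * (4 * dist v w)"
        using le pr a by (intro add_mono mult_mono) auto
      finally show ?thesis by (simp add: F dist_real_def)
    next
      case False
      then show ?thesis using a by (auto simp: F f_def)
    qed
  qed
  then have "(8 * a ^ n)-lipschitz_on UNIV F" using a by (intro lipschitz_onI) auto
  then obtain u where u0: "u 0 = Bcontfun (\<lambda>k. if k = n then 1 else 0)"
    and u: "\<And>t. t \<ge> 0 \<Longrightarrow> (u has_vector_derivative F (u t)) (at t within {0..})"
    by (rule lipschitz_ode_global_solution[where F = F]) blast
  define y where "y t k = apply_bcontfun (u t) k" for t k
  have y0: "y 0 k = (if k = n then 1 else 0)" for k
    unfolding y_def u0 by (subst Bcontfun_inverse) (auto intro: supp)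
  have y: "((\<lambda>t. y t k) has_real_derivative f (y t) k) (at t within {0..})" if "t \<ge> 0" for t k
    using bounded_linear.has_vector_derivative[OF bounded_linear_apply_bcontfun u[OF that], of k]
    unfolding F has_real_derivative_iff_has_vector_derivative by (simp add: y_def[abs_def])
  have zero: "y t k = 0" if "t \<ge> 0" "k = 0 \<or> k > n" for t k
  proof -
    have "((\<lambda>t. y t k) has_real_derivative 0) (at t within {0..})" if "t \<ge> 0" for t
      using y[OF that, of k] \<open>k = 0 \<or> k > n\<close> by (auto simp: f_def)
    then have "\<exists>C. \<forall>t\<in>{0..}. y t k = C"
      by (intro has_field_derivative_zero_constant) auto
    then have "y t k = y 0 k" using \<open>t \<ge> 0\<close> by auto
    then show ?thesis using y0 that n by auto
  qed
  \<comment> \<open>Where \<open>y t k < 0\<close> its clamp is 0, so the loss term disappears and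
    the derivative is a multiple of a square.\<close>
  have nonneg: "y t k \<ge> 0" if "t \<ge> 0" for t k
    by (rule nonneg_of_derivative_nonneg_below_zero[OF y _ _ that])
      (use y0 a in \<open>auto simp: f_def clamp02_def\<close>)
  define E where "E t = (\<Sum>k=1..n. (y t k)\<^sup>2)" for t
  have E': "(E has_real_derivative (\<Sum>k=1..n. 2 * y t k * f (y t) k)) (at t within {0..})" if "t \<ge> 0" for t
  proof -
    have "((\<lambda>u. (y u k)\<^sup>2) has_real_derivative 2 * y t k * f (y t) k) (at t within {0..})" for k
      using that by (auto intro!: derivative_eq_intros y)
    then show ?thesis unfolding E_def[abs_def] by (intro DERIV_sum) auto
  qed
  have small: "clamp02 (y t k) = y t k" if "t \<ge> 0" "E t < 2" for t k
  proof (cases "k \<in> {1..n}")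
    case True
    then have "(y t k)\<^sup>2 \<le> E t"
      unfolding E_def by (intro member_le_sum[of k _ "\<lambda>k. (y t k)\<^sup>2"]) auto
    with that have "(y t k)\<^sup>2 < 2\<^sup>2" by simp
    then have "y t k < 2" by (rule power_less_imp_less_base) simp
    then show ?thesis using nonneg[OF that(1), of k] by (simp add: clamp02_def)
  next
    case False
    then have "y t k = 0" using zero[OF that(1), of k] by auto
    then show ?thesis by (simp add: clamp02_def)
  qed
  have E'0: "(\<Sum>k=1..n. 2 * y t k * f (y t) k) = 0" if "t \<ge> 0" "E t < 2" for t
  proof -
    have "(\<Sum>k=1..n. 2 * y t k * f (y t) k)
      = (\<Sum>k=1..n. 1 ^ k * (2 * y t k * (a ^ k * (y t (k + 1))\<^sup>2 - a ^ (k - 1) * y t (k - 1) * y t k)))"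
      by (intro sum.cong) (auto simp: f_def small[OF that])
    also have "\<dots> = 0"
      by (subst weighted_energy_balance) (auto simp: zero[OF that(1)])
    finally show ?thesis .
  qed
  have E0: "E 0 = 1" using n by (simp add: E_def y0 if_distrib[of "\<lambda>z. z\<^sup>2"] sum.delta cong: if_cong)
  \<comment> \<open>Continuation argument: before the first time \<open>s\<close> with
    \<open>E s >= 2\<close> the clamp is inactive and the energy is constant, so
    \<open>E s <= E 0 = 1\<close>.\<close>
  have E2: "E t < 2" if t: "t \<ge> 0" for t
  proof (rule ccontr)
    assume "\<not> E t < 2"
    define S where "S = {0..t} \<inter> E -` {2..}"
    have "continuous_on {0..} E"
      by (rule DERIV_continuous_on[of _ _ "\<lambda>t. \<Sum>k=1..n. 2 * y t k * f (y t) k"]) (use E' in auto)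
    then have "compact S"
      unfolding S_def
      by (intro compact_Int_closed[of "{0..t}" "{0..t} \<inter> E -` {2..}", simplified Int_left_absorb]
          continuous_closed_preimage) (auto intro: continuous_on_subset)
    moreover have "t \<in> S" using \<open>\<not> E t < 2\<close> t by (simp add: S_def)
    ultimately obtain s where s: "s \<in> S" "\<And>u. u \<in> S \<Longrightarrow> s \<le> u"
      using compact_attains_inf[of S] by blast
    have "0 * (s - 0) \<le> - E s - - E 0"
    proof (rule increment_ge_of_derivative_ge)
      show "0 \<le> s" using s by (simp add: S_def)
      show "((\<lambda>u. - E u) has_real_derivative - (\<Sum>k=1..n. 2 * y u k * f (y u) k)) (at u within {0..s})"
        if "0 \<le> u" "u \<le> s" for u
        by (rule DERIV_minus[OF DERIV_subset[OF E']]) (use that in auto)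
      show "0 \<le> - (\<Sum>k=1..n. 2 * y u k * f (y u) k)" if "0 < u" "u < s" for u
        using E'0[of u] s(2)[of u] s(1) that by (fastforce simp: S_def)
    qed
    then show False using s(1) E0 by (simp add: S_def)
  qed
  have "galerkin a n y"
  proof
    fix t :: real and k :: nat assume t: "t \<ge> 0"
    show "((\<lambda>u. y u k) has_real_derivative a ^ k * (y t (k + 1))\<^sup>2 - a ^ (k - 1) * y t (k - 1) * y t k)
      (at t within {0..})" if "k \<ge> 1"
      using y[OF t, of k] zero[OF t, of k] zero[OF t, of "k + 1"] that
      by (cases "k \<le> n") (auto simp: f_def small[OF t E2[OF t]])
  qed (use a nonneg zero E0 in \<open>auto simp: E_def\<close>)
  then show ?thesis using y0 by auto
qed

section \<open>Passage to the limit\<close>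

text \<open>Diagonal extraction over the countably many pairs of a rational time and a mode; the
  Lipschitz bound, uniform in \<open>n\<close>, carries the Cauchy property to all real
  times.\<close>

lemma equi_Lipschitz_convergent_subsequence:
  fixes f :: "nat \<Rightarrow> real \<Rightarrow> nat \<Rightarrow> real"
  assumes bound: "\<And>n t k. t \<ge> 0 \<Longrightarrow> \<bar>f n t k\<bar> \<le> M"
    and Lip: "\<And>n s t k. 0 \<le> s \<Longrightarrow> 0 \<le> t \<Longrightarrow> \<bar>f n t k - f n s k\<bar> \<le> L k * \<bar>t - s\<bar>"
  obtains r X where "strict_mono (r :: nat \<Rightarrow> nat)"
    and "\<And>t k. t \<ge> 0 \<Longrightarrow> (\<lambda>i. f (r i) t k) \<longlonglongrightarrow> X t k"
proof -
  obtain r :: "nat \<Rightarrow> nat" where r: "strict_mono r"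
    and conv: "\<And>p. p \<in> (\<rat> \<inter> {0..}) \<times> UNIV \<Longrightarrow> \<exists>l. (\<lambda>i. (\<lambda>(t, k). f (r i) t k) p) \<longlonglongrightarrow> l"
  proof (rule function_convergent_subsequence[of "(\<rat> \<inter> {0::real..}) \<times> (UNIV :: nat set)"
        "\<lambda>n (t, k). f n t k" M])
    show "countable ((\<rat> \<inter> {0::real..}) \<times> (UNIV :: nat set))"
      using countable_rat by (intro countable_SIGMA) auto
  qed (use bound in auto)
  have "Cauchy (\<lambda>i. f (r i) t k)" if t: "t \<ge> 0" for t k
  proof (rule metric_CauchyI)
    fix e :: real assume e: "e > 0"
    define l where "l = \<bar>L k\<bar> + 1"
    define \<delta> where "\<delta> = e / (3 * l)"
    have l0: "l > 0" by (simp add: l_def)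
    have d0: "\<delta> > 0" using e l0 by (simp add: \<delta>_def)
    \<comment> \<open>The rational time lies above \<open>t\<close>, hence in the half-line where
      the bounds hold.\<close>
    obtain q where q: "q \<in> \<rat>" "t < q" "q < t + \<delta>"
      using Rats_dense_in_real[of t "t + \<delta>"] d0 by auto
    have close: "\<bar>f n t k - f n q k\<bar> < e / 3" for n
    proof -
      have "\<bar>f n t k - f n q k\<bar> \<le> L k * \<bar>t - q\<bar>" using Lip[of q t n k] t q by simp
      also have "\<dots> \<le> l * \<bar>t - q\<bar>" by (intro mult_right_mono) (auto simp: l_def)
      also have "\<dots> < l * \<delta>" using q l0 by (intro mult_strict_left_mono) auto
      also have "\<dots> = e / 3" using l0 by (simp add: \<delta>_def)
      finally show ?thesis .
    qed
    have "Cauchy (\<lambda>i. f (r i) q k)"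
      using conv[of "(q, k)"] q t by (auto intro: LIMSEQ_imp_Cauchy)
    then obtain N where N: "\<And>i j. i \<ge> N \<Longrightarrow> j \<ge> N \<Longrightarrow> dist (f (r i) q k) (f (r j) q k) < e / 3"
      using metric_CauchyD[of _ "e/3"] e by (metis zero_less_divide_iff zero_less_numeral)
    have "dist (f (r i) t k) (f (r j) t k) < e" if "i \<ge> N" "j \<ge> N" for i j
      using N[OF that] close[of "r i"] close[of "r j"] unfolding dist_real_def by linarith
    then show "\<exists>N. \<forall>i\<ge>N. \<forall>j\<ge>N. dist (f (r i) t k) (f (r j) t k) < e" by blast
  qed
  then have "(\<lambda>i. f (r i) t k) \<longlonglongrightarrow> lim (\<lambda>i. f (r i) t k)" if "t \<ge> 0" for t k
    using that by (simp add: convergent_LIMSEQ_iff[symmetric] Cauchy_convergent)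
  with r show ?thesis by (rule that)
qed

section \<open>Bounds and integral form that survive the limit\<close>

context galerkin
begin

text \<open>Both terms lie between 0 and \<open>a ^ k\<close>, hence so does the size of their
  difference. Being independent of \<open>n\<close>, the bound gives equicontinuity and the
  dominating function for the limit.\<close>

lemma rhs_le:
  assumes "t \<ge> 0"
  shows "\<bar>a ^ k * (x t (k + 1))\<^sup>2 - a ^ (k - 1) * x t (k - 1) * x t k\<bar> \<le> a ^ k"
proof -
  have 1: "a ^ k * (x t (k + 1))\<^sup>2 \<le> a ^ k * 1"
    using a_gt_1 le_1[OF assms, of "k+1"] nonneg[OF assms, of "k+1"]
    by (intro mult_left_mono) (auto simp: abs_square_le_1)
  have 2: "a ^ (k - 1) * (x t (k - 1) * x t k) \<le> a ^ k * (1 * 1)"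
    using a_gt_1 le_1[OF assms] nonneg[OF assms]
    by (intro mult_mono power_increasing) auto
  have 3: "0 \<le> a ^ k * (x t (k + 1))\<^sup>2" "0 \<le> a ^ (k - 1) * (x t (k - 1) * x t k)"
    using a_gt_1 nonneg[OF assms] by auto
  show ?thesis using 1 2 3 by (simp only: abs_le_iff mult.assoc) linarith
qed

lemma Lipschitz:
  assumes "0 \<le> s" "0 \<le> t"
  shows "\<bar>x t k - x s k\<bar> \<le> a ^ k * \<bar>t - s\<bar>"
proof (cases "k = 0")
  case True
  then show ?thesis using vanishes[of t k] vanishes[of s k] assms by simp
next
  case False
  then have "norm (x t k - x s k) \<le> a ^ k * norm (t - s)"
    using assms rhs_le
    by (intro field_differentiable_bound[of "{0..}" "\<lambda>u. x u k"
        "\<lambda>t. a ^ k * (x t (k + 1))\<^sup>2 - a ^ (k - 1) * x t (k - 1) * x t k"] deriv) auto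
  then show ?thesis by simp
qed

text \<open>In integrated form the equation passes to the limit under mere pointwise
  convergence.\<close>

lemma integral_equation:
  assumes t: "0 \<le> t" and k: "k \<ge> 1"
  shows "((\<lambda>u. a ^ k * (x u (k + 1))\<^sup>2 - a ^ (k - 1) * x u (k - 1) * x u k)
    has_integral x t k - x 0 k) {0..t}"
proof (rule fundamental_theorem_of_calculus[OF t])
  fix u assume "u \<in> {0..t}"
  then show "((\<lambda>u. x u k) has_vector_derivative
      a ^ k * (x u (k + 1))\<^sup>2 - a ^ (k - 1) * x u (k - 1) * x u k) (at u within {0..t})"
    unfolding has_real_derivative_iff_has_vector_derivative[symmetric]
    by (intro DERIV_subset[OF deriv[OF _ k]]) auto
qed

lemma energy_sums: "(\<lambda>k. c ^ k * (x t k)\<^sup>2) sums energy c t" if "t \<ge> 0"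
  unfolding energy_def by (rule sums_finite) (use vanishes[OF that] in \<open>auto simp: not_le\<close>)

end

text \<open>As \<open>n \<rightarrow> \<infinity>\<close> the initial data \<open>e\<^sub>n\<close> tend to \<open>0\<close> in every component,
  while the energy bounds of weight \<open>C > 1\<close> keep the unit \<open>\<ell>\<^sup>2\<close> norm at positive times from escaping
  to \<open>k = \<infinity>\<close>.\<close>

lemma anomalous_solution_exists:
  fixes a :: real
  assumes a: "a > 1"
  obtains X :: "real \<Rightarrow> nat \<Rightarrow> real" where
    "\<And>t k. t \<ge> 0 \<Longrightarrow> 0 \<le> X t k"
    "\<And>t k. t \<ge> 0 \<Longrightarrow> X t k \<le> 1"
    "\<And>t. t \<ge> 0 \<Longrightarrow> X t 0 = 0"
    "\<And>k. X 0 k = 0"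
    "\<And>t k. t \<ge> 0 \<Longrightarrow> X t k \<le> a ^ k * t"
    "\<And>k. continuous_on {0..} (\<lambda>t. X t k)"
    "\<And>t k. t \<ge> 0 \<Longrightarrow> k \<ge> 1 \<Longrightarrow> ((\<lambda>u. X u k) has_real_derivative
      a ^ k * (X t (k + 1))\<^sup>2 - a ^ (k - 1) * X t (k - 1) * X t k) (at t within {0..})"
    "\<And>C \<tau>. 1 < C \<Longrightarrow> C < a\<^sup>2 \<Longrightarrow> \<tau> > 0 \<Longrightarrow> \<exists>B. \<forall>t\<ge>\<tau>. \<forall>k. C ^ k * (X t k)\<^sup>2 \<le> B"
    "\<And>t. t > 0 \<Longrightarrow> (\<lambda>k. (X t k)\<^sup>2) sums 1"
proof -
  have "\<forall>n. \<exists>x. galerkin a (Suc n) x \<and> (\<forall>k. k \<noteq> Suc n \<longrightarrow> x 0 k = 0)"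
    using galerkin_exists[OF a] by simp
  from choice[OF this] obtain x where
    "\<forall>n. galerkin a (Suc n) (x n) \<and> (\<forall>k. k \<noteq> Suc n \<longrightarrow> x n 0 k = 0)" ..
  then have x: "galerkin a (Suc n) (x n)" and x0: "k \<noteq> Suc n \<Longrightarrow> x n 0 k = 0" for n k
    by simp_all
  have x01: "0 \<le> x n t k" "x n t k \<le> 1" if "t \<ge> 0" for n t k
    using galerkin.nonneg[OF x that] galerkin.le_1[OF x that] by auto
  obtain r X where r: "strict_mono (r :: nat \<Rightarrow> nat)"
    and lim: "\<And>t k. t \<ge> 0 \<Longrightarrow> (\<lambda>i. x (r i) t k) \<longlonglongrightarrow> X t k"
    using equi_Lipschitz_convergent_subsequence[of x 1 "\<lambda>k. a ^ k"] galerkin.Lipschitz[OF x] x01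
    by (metis abs_of_nonneg)
  have X0: "0 \<le> X t k" if "t \<ge> 0" for t k
    by (rule LIMSEQ_le_const[OF lim[OF that]]) (use x01 that in auto)
  have X1: "X t k \<le> 1" if "t \<ge> 0" for t k
    by (rule LIMSEQ_le_const2[OF lim[OF that]]) (use x01 that in auto)
  have Xz: "X t 0 = 0" if "t \<ge> 0" for t
    using lim[OF that, of 0] galerkin.vanishes[OF x that] by (simp add: LIMSEQ_const_iff)
  have Xi: "X 0 k = 0" for k
  proof (rule LIMSEQ_unique[OF lim])
    \<comment> \<open>Since \<open>r i >= i\<close>, the only charged mode \<open>Suc (r i)\<close>
      has passed \<open>k\<close> once \<open>i >= k\<close>.\<close>
    have "eventually (\<lambda>i. x (r i) 0 k = 0) sequentially"
      using eventually_ge_at_top[of k]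
    proof eventually_elim
      case (elim i)
      then have "k \<noteq> Suc (r i)" using seq_suble[OF r, of i] by simp
      then show ?case by (rule x0)
    qed
    then show "(\<lambda>i. x (r i) 0 k) \<longlonglongrightarrow> 0" by (rule tendsto_eventually)
  qed simp
  have XL: "\<bar>X t k - X s k\<bar> \<le> a ^ k * \<bar>t - s\<bar>" if "0 \<le> s" "0 \<le> t" for s t k
    by (rule LIMSEQ_le_const2[OF tendsto_rabs[OF tendsto_diff[OF lim[OF that(2)] lim[OF that(1)]]]])
      (use galerkin.Lipschitz[OF x that] in auto)
  have Xle: "X t k \<le> a ^ k * t" if "t \<ge> 0" for t k
    using XL[of 0 t k] that Xi by simp
  have Xcont: "continuous_on {0..} (\<lambda>t. X t k)" for k
  proof (rule lipschitz_on_continuous_on)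
    show "(a ^ k)-lipschitz_on {0..} (\<lambda>t. X t k)"
      using XL a by (intro lipschitz_onI) (auto simp: dist_real_def)
  qed
  define R where "R z k = a ^ k * (z (k + 1))\<^sup>2 - a ^ (k - 1) * z (k - 1) * z k"
    for z :: "nat \<Rightarrow> real" and k
  have Rcont: "continuous_on {0..} (\<lambda>u. R (X u) k)" for k
    unfolding R_def by (intro continuous_intros Xcont)
  have XI: "X t k = integral {0..t} (\<lambda>u. R (X u) k)" if t: "t \<ge> 0" and k: "k \<ge> 1" for t k
  proof (rule LIMSEQ_unique)
    have "(\<lambda>i. integral {0..t} (\<lambda>u. R (x (r i) u) k)) \<longlonglongrightarrow> integral {0..t} (\<lambda>u. R (X u) k)"
    proof (rule dominated_convergence(2)[where h = "\<lambda>_. a ^ k"])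
      show "(\<lambda>u. R (x (r i) u) k) integrable_on {0..t}" for i
        using galerkin.integral_equation[OF x t k] unfolding R_def by (rule has_integral_integrable)
      show "norm (R (x (r i) u) k) \<le> a ^ k" if "u \<in> {0..t}" for i u
        using galerkin.rhs_le[OF x, of u] that unfolding R_def by simp
      show "(\<lambda>i. R (x (r i) u) k) \<longlonglongrightarrow> R (X u) k" if "u \<in> {0..t}" for u
        unfolding R_def using that by (intro tendsto_intros lim) auto
    qed auto
    moreover have "integral {0..t} (\<lambda>u. R (x (r i) u) k) = x (r i) t k - x (r i) 0 k" for i
      using galerkin.integral_equation[OF x t k] unfolding R_def by (rule integral_unique)
    ultimately show "(\<lambda>i. x (r i) t k - x (r i) 0 k) \<longlonglongrightarrow> integral {0..t} (\<lambda>u. R (X u) k)" by simp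
    show "(\<lambda>i. x (r i) t k - x (r i) 0 k) \<longlonglongrightarrow> X t k"
      using tendsto_diff[OF lim[OF t, of k] lim[of 0 k]] Xi by simp
  qed
  have Xderiv: "((\<lambda>u. X u k) has_real_derivative R (X t) k) (at t within {0..})"
    if t: "t \<ge> 0" and k: "k \<ge> 1" for t k
    unfolding has_real_derivative_iff_has_vector_derivative
    by (rule has_vector_derivative_transform[OF _ _ integral_has_vector_derivative_atLeast[OF Rcont t]])
      (use t XI k in auto)
  have Xbd: "\<exists>B. \<forall>n. \<forall>t\<ge>\<tau>. \<forall>k. C ^ k * (x n t k)\<^sup>2 \<le> B \<and> C ^ k * (X t k)\<^sup>2 \<le> B"
    if C: "1 < C" "C < a\<^sup>2" and \<tau>: "\<tau> > 0" for C \<tau>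
  proof -
    obtain B where B: "\<And>n x t. galerkin a n x \<Longrightarrow> t \<ge> \<tau> \<Longrightarrow> galerkin.energy n x C t \<le> B"
      using galerkin_energy_bounded[OF C a \<tau>] by blast
    have 1: "C ^ k * (x n t k)\<^sup>2 \<le> B" if "t \<ge> \<tau>" for n t k
      using galerkin.le_energy[OF x, of C t k n] B[OF x that, of n] that \<tau> C by simp
    have "C ^ k * (X t k)\<^sup>2 \<le> B" if "t \<ge> \<tau>" for t k
      by (rule LIMSEQ_le_const2[OF tendsto_mult_left[OF tendsto_power[OF lim]]])
        (use 1 that \<tau> in auto)
    with 1 show ?thesis by blast
  qed
  have Xsums: "(\<lambda>k. (X t k)\<^sup>2) sums 1" if t: "t > 0" for t
  proof -
    \<comment> \<open>Any weight strictly between 1 and \<open>a\<^sup>2\<close> serves: the energy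
      bound dominates the series by a geometric one uniformly in \<open>n\<close>, and Tannery's
      theorem carries the unit sum to the limit.\<close>
    define C where "C = a"
    have C: "1 < C" "C < a\<^sup>2" using a by (auto simp: C_def power2_eq_square)
    obtain B where B: "\<And>n k. C ^ k * (x n t k)\<^sup>2 \<le> B"
      using Xbd[OF C t] by blast
    have le: "(x n t k)\<^sup>2 \<le> B * (1 / C) ^ k" for n k
      using B[of k n] C by (simp add: power_one_over field_simps)
    have lim2: "((\<lambda>n. (x (r n) t k)\<^sup>2) \<longlongrightarrow> (X t k)\<^sup>2) sequentially" for k
      using t by (intro tendsto_intros lim) auto
    have dom: "\<forall>\<^sub>F (k, n) in sequentially \<times>\<^sub>F sequentially.
        norm ((x (r n) t k)\<^sup>2) \<le> B * (1 / C) ^ k"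
      using le by (intro always_eventually) auto
    have sm: "summable (\<lambda>k. B * (1 / C) ^ k)"
      using C by (intro summable_mult summable_geometric) auto
    have *: "summable (\<lambda>k. norm ((X t k)\<^sup>2))"
        "(\<lambda>n. \<Sum>k. (x (r n) t k)\<^sup>2) \<longlonglongrightarrow> (\<Sum>k. (X t k)\<^sup>2)"
      using tannerys_theorem[OF lim2 dom sm sequentially_bot] by blast+
    have "(\<lambda>k. (x n t k)\<^sup>2) sums 1" for n
      using galerkin.energy_sums[OF x, of t 1 n] galerkin.energy_conserved[OF x, of t n] t by simp
    then have "(\<Sum>k. (x (r n) t k)\<^sup>2) = 1" for n by (simp add: sums_iff)
    with *(2) have "(\<Sum>k. (X t k)\<^sup>2) = 1" by (simp add: LIMSEQ_const_iff)
    with *(1) show ?thesis by (simp add: sums_iff)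
  qed
  show ?thesis
  proof
    show "\<exists>B. \<forall>t\<ge>\<tau>. \<forall>k. C ^ k * (X t k)\<^sup>2 \<le> B" if "1 < C" "C < a\<^sup>2" "\<tau> > 0" for C \<tau>
      using Xbd[OF that] by blast
  qed (use X0 X1 Xz Xi Xle Xcont Xderiv Xsums in \<open>auto simp: R_def\<close>)
qed

section \<open>Sobolev norms\<close>

lemma has_sum_atLeast_1_of_nonneg:
  fixes f :: "nat \<Rightarrow> real"
  assumes "f sums S" and "\<And>k. f k \<ge> 0" and "f 0 = 0"
  shows "(f has_sum S) {1..}"
proof -
  have "(f has_sum S) UNIV"
    using assms by (intro norm_summable_imp_has_sum) (auto simp: sums_iff)
  then show ?thesis
    by (rule has_sum_cong_neutral[THEN iffD1, rotated -1]) (use assms in \<open>auto simp: not_le\<close>)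
qed

lemma freq_powr:
  assumes "lam > 0"
  shows "freq lam k powr s = (lam powr s) ^ k"
  using assms by (simp add: freq_def powr_realpow[symmetric] powr_powr mult.commute)

text \<open>Ordinary series from index 0 compute the unordered sums over \<open>{1..}\<close>
  because \<open>x 0 = 0\<close>. The \<open>sums\<close> hypothesis excludes the default value of a
  divergent sum.\<close>

lemma weighted_sums:
  fixes x :: "nat \<Rightarrow> real"
  assumes "lam > 0" and "x 0 = 0" and "(\<lambda>k. (lam powr (2 * s)) ^ k * (x k)\<^sup>2) sums S"
  shows in_H_space_of_sums: "x \<in> H_space lam s" and H_norm_of_sums: "H_norm lam s x = sqrt S"
proof -
  have "((\<lambda>k. freq lam k powr (2 * s) * (x k)\<^sup>2) has_sum S) {1..}"
    using has_sum_atLeast_1_of_nonneg[OF assms(3)] assms(1,2) by (simp add: freq_powr)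
  then show "x \<in> H_space lam s" and "H_norm lam s x = sqrt S"
    unfolding H_space_def H_norm_def by (auto simp: infsumI summable_on_def)
qed

lemma summable_geometric_bound:
  fixes w C B :: real
  assumes "0 \<le> w" "w < C"
  shows "summable (\<lambda>k. B * (w / C) ^ k)"
  using assms by (intro summable_mult summable_geometric) auto

lemma weighted_le_geometric:
  fixes w C B y :: real
  assumes "0 \<le> w" "0 < C" "C ^ k * y\<^sup>2 \<le> B"
  shows "w ^ k * y\<^sup>2 \<le> B * (w / C) ^ k"
proof -
  have "w ^ k * y\<^sup>2 = (w / C) ^ k * (C ^ k * y\<^sup>2)"
    using assms by (simp add: power_divide)
  also have "\<dots> \<le> (w / C) ^ k * B" using assms by (intro mult_left_mono) auto
  finally show ?thesis by (simp add: mult.commute)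
qed

text \<open>The gap between the weight of \<open>H_space\<close> and \<open>C\<close> gives a
  geometric majorant of the tail, so Tannery's theorem reduces continuity in norm to continuity of
  each component. A bound local in time is enough, as needed near \<open>t = 0\<close>.\<close>

lemma continuous_into_H_of_geometric_bound:
  fixes X :: "real \<Rightarrow> nat \<Rightarrow> real"
  assumes lam: "lam > 0" and zero: "\<And>t. t \<in> I \<Longrightarrow> X t 0 = 0"
    and cont: "\<And>k. continuous_on I (\<lambda>t. X t k)"
    and C: "lam powr (2 * s) < C"
    and bound: "\<And>t. t \<in> I \<Longrightarrow> \<exists>U B. open U \<and> t \<in> U \<and> (\<forall>u\<in>U \<inter> I. \<forall>k. C ^ k * (X u k)\<^sup>2 \<le> B)"
  shows "continuous_into_H lam s I X"
  unfolding continuous_into_H_def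
proof (intro conjI ballI)
  define w where "w = lam powr (2 * s)"
  have w: "0 \<le> w" "w < C" using C by (auto simp: w_def)
  fix t assume t: "t \<in> I"
  obtain U B where U: "open U" "t \<in> U" and B: "\<And>u k. u \<in> U \<Longrightarrow> u \<in> I \<Longrightarrow> C ^ k * (X u k)\<^sup>2 \<le> B"
    using bound[OF t] by blast
  have "summable (\<lambda>k. w ^ k * (X t k)\<^sup>2)"
    by (rule summable_comparison_test'[OF summable_geometric_bound[OF w, of B], of 0])
      (use weighted_le_geometric[OF w(1) _ B[OF U(2) t]] w in auto)
  then show "X t \<in> H_space lam s"
    unfolding w_def by (rule in_H_space_of_sums[where x = "X t", OF lam zero[OF t] summable_sums])
  define d where "d k u = w ^ k * (X u k - X t k)\<^sup>2" for k u
  show "((\<lambda>u. H_norm lam s (\<lambda>k. X u k - X t k)) \<longlongrightarrow> 0) (at t within I)"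
  \<comment> \<open>Tannery's theorem needs a non-trivial filter; at an isolated point of
    \<open>I\<close> the limit is vacuous.\<close>
  proof (cases "at t within I = bot")
    case False
    have ev: "\<forall>\<^sub>F u in at t within I. u \<in> U \<inter> I"
      using U by (auto simp: eventually_at_topological)
    have le: "norm (d k u) \<le> (4 * B) * (w / C) ^ k" if "u \<in> U \<inter> I" for k u
    proof -
      have "C ^ k * (X u k - X t k)\<^sup>2 \<le> C ^ k * (2 * (X u k)\<^sup>2 + 2 * (X t k)\<^sup>2)"
        using w zero_le_power2[of "X u k + X t k"]
        by (intro mult_left_mono) (auto simp: power2_eq_square algebra_simps)
      also have "\<dots> \<le> 4 * B"
        using B[of u k] B[OF U(2) t, of k] that by (simp add: distrib_left)
      finally show ?thesis
        using weighted_le_geometric[OF w(1), of C k "X u k - X t k" "4 * B"] w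
        by (simp add: d_def)
    qed
    have lim: "(d k \<longlongrightarrow> 0) (at t within I)" for k
    proof -
      have "((\<lambda>u. X u k) \<longlongrightarrow> X t k) (at t within I)"
        using cont[of k] t by (simp add: continuous_on_def)
      then have "(d k \<longlongrightarrow> w ^ k * (X t k - X t k)\<^sup>2) (at t within I)"
        unfolding d_def by (intro tendsto_intros)
      then show ?thesis by simp
    qed
    have evp: "\<forall>\<^sub>F (k, u) in sequentially \<times>\<^sub>F (at t within I). norm (d k u) \<le> (4 * B) * (w / C) ^ k"
      using eventually_prodI[OF eventually_True ev, of sequentially]
      by (rule eventually_mono) (use le in auto)
    have T: "\<forall>\<^sub>F u in at t within I. summable (\<lambda>k. norm (d k u))"
        "((\<lambda>u. \<Sum>k. d k u) \<longlongrightarrow> (\<Sum>k. 0)) (at t within I)"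
      using tannerys_theorem[OF lim evp summable_geometric_bound[OF w] False] by auto
    have "\<forall>\<^sub>F u in at t within I. H_norm lam s (\<lambda>k. X u k - X t k) = sqrt (\<Sum>k. d k u)"
      using T(1) ev
    proof eventually_elim
      case (elim u)
      then have "(\<lambda>k. d k u) sums (\<Sum>k. d k u)" by (intro summable_sums) (rule summable_norm_cancel)
      then show ?case
        using elim zero[of u] zero[OF t] unfolding d_def w_def
          by (intro H_norm_of_sums[where x = "\<lambda>k. X u k - X t k"] lam) auto
    qed
    moreover have "((\<lambda>u. sqrt (\<Sum>k. d k u)) \<longlongrightarrow> 0) (at t within I)"
      using tendsto_real_sqrt[OF T(2)] by simp
    ultimately show ?thesis by (simp add: tendsto_cong)
  qed simp
qed

text \<open>At times \<open>t \<lesssim> a\<^sup>-\<^sup>m\<close> the first \<open>m\<close> modes carry at most half of the energy.\<close>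

lemma H_norm_lower_bound:
  fixes x :: "nat \<Rightarrow> real"
  assumes lam: "lam > 1" and r: "r > 0" and a: "a = lam powr \<alpha>" "\<alpha> > 0"
    and x0: "x 0 = 0" and H: "x \<in> H_space lam r" and one: "(\<lambda>k. (x k)\<^sup>2) sums 1"
    and le: "\<And>k. 0 \<le> x k \<and> x k \<le> a ^ k * t"
    and t: "0 < t" "t \<le> \<gamma>" and \<gamma>: "\<gamma>\<^sup>2 = (1 - 1 / a\<^sup>2) / 2" "\<gamma> > 0"
  shows "H_norm lam r x \<ge> sqrt (1/2) * \<gamma> powr (r / \<alpha>) * t powr (- r / \<alpha>)"
proof -
  have a1: "a > 1" using lam a by simp
  define w where "w = lam powr (2 * r)"
  have w1: "w > 1" using lam r by (simp add: w_def)
  \<comment> \<open>\<open>m\<close> is the last index with \<open>a ^ m * t <= \<gamma>\<close>;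
    index 0 qualifies because \<open>t <= \<gamma>\<close>.\<close>
  obtain m where m: "a ^ m * t \<le> \<gamma>" "\<gamma> < a ^ Suc m * t"
  proof -
    obtain i where "\<gamma> / t < a ^ i" using real_arch_pow[OF a1] by blast
    then have ex: "\<exists>i. \<gamma> < a ^ i * t" using t by (auto simp: field_simps)
    define j where "j = (LEAST i. \<gamma> < a ^ i * t)"
    have j: "\<gamma> < a ^ j * t" unfolding j_def by (rule LeastI_ex[OF ex])
    with t have "j \<noteq> 0" by (metis linorder_not_less mult_1 power_0)
    then obtain i where i: "j = Suc i" by (cases j) auto
    then have "\<not> \<gamma> < a ^ i * t" using not_less_Least[of i "\<lambda>i. \<gamma> < a ^ i * t"] by (simp add: j_def)
    then show ?thesis using that[of i] j i by simp
  qed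
  \<comment> \<open>Down from mode \<open>m\<close> the bounds decay geometrically, and
    \<open>\<gamma>\<close> is chosen so that their squares sum to at most 1/2.\<close>
  have low: "(\<Sum>k\<le>m. (x k)\<^sup>2) \<le> 1/2"
  proof -
    have "(\<Sum>k\<le>m. (x k)\<^sup>2) \<le> (\<Sum>k\<le>m. \<gamma>\<^sup>2 * (1 / a\<^sup>2) ^ (m - k))"
    proof (rule sum_mono)
      fix k assume k: "k \<in> {..m}"
      have "x k \<le> a ^ k * t" using le by blast
      also have "a ^ k * t = a ^ m * t / a ^ (m - k)"
        using k a1 by (simp add: power_diff field_simps)
      also have "\<dots> \<le> \<gamma> / a ^ (m - k)" using m a1 by (intro divide_right_mono) auto
      finally have "(x k)\<^sup>2 \<le> (\<gamma> / a ^ (m - k))\<^sup>2" using le by (intro power_mono) auto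
      then show "(x k)\<^sup>2 \<le> \<gamma>\<^sup>2 * (1 / a\<^sup>2) ^ (m - k)"
        by (simp add: power_divide power_mult[symmetric] mult.commute)
    qed
    also have "\<dots> = \<gamma>\<^sup>2 * (\<Sum>k\<le>m. (1 / a\<^sup>2) ^ (m - k))" by (simp add: sum_distrib_left)
    also have "(\<Sum>k\<le>m. (1 / a\<^sup>2) ^ (m - k)) = (\<Sum>k\<le>m. (1 / a\<^sup>2) ^ k)"
      by (rule sum.nat_diff_reindex[of "\<lambda>k. (1 / a\<^sup>2) ^ k" "Suc m", unfolded lessThan_Suc_atMost, simplified])
    also have "\<gamma>\<^sup>2 * \<dots> \<le> \<gamma>\<^sup>2 * (1 / (1 - 1 / a\<^sup>2))"
    proof (rule mult_left_mono)
      have "norm (1 / a\<^sup>2) < 1" using a1 by simp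
      then have "(\<Sum>k\<le>m. (1 / a\<^sup>2) ^ k) \<le> (\<Sum>k. (1 / a\<^sup>2) ^ k)"
        using a1 by (intro sum_le_suminf summable_geometric) auto
      then show "(\<Sum>k\<le>m. (1 / a\<^sup>2) ^ k) \<le> 1 / (1 - 1 / a\<^sup>2)"
        using suminf_geometric[OF \<open>norm (1 / a\<^sup>2) < 1\<close>] by simp
    qed simp
    also have "\<gamma>\<^sup>2 * (1 / (1 - 1 / a\<^sup>2)) = 1/2"
    proof -
      have "1 - 1 / a\<^sup>2 \<noteq> 0" using one_less_power[OF a1, of 2] by simp
      moreover have "y / 2 * (1 / y) = 1/2" if "y \<noteq> 0" for y :: real using that by simp
      ultimately show ?thesis unfolding \<gamma> by blast
    qed
    finally show ?thesis by simp
  qed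
  \<comment> \<open>Membership in \<open>H_space\<close> is essential: a divergent sum would give
    \<open>H_norm\<close> the value 0.\<close>
  have "(\<lambda>k. w ^ k * (x k)\<^sup>2) summable_on {1..}"
    using H lam by (simp add: H_space_def freq_powr w_def)
  then have "(\<lambda>k. w ^ k * (x k)\<^sup>2) summable_on UNIV"
    by (rule summable_on_cong_neutral[THEN iffD1, rotated -1]) (auto simp: x0 not_le)
  then have "summable (\<lambda>k. w ^ k * (x k)\<^sup>2)" by (rule summable_on_imp_summable)
  then obtain S where S: "(\<lambda>k. w ^ k * (x k)\<^sup>2) sums S" by (auto simp: summable_def)
  \<comment> \<open>The modes above \<open>m\<close> carry at least half of the energy, each with
    weight at least \<open>w ^ Suc m\<close>.\<close>
  have up: "(\<lambda>k. w ^ Suc m * ((x k)\<^sup>2 - (if k \<in> {..m} then (x k)\<^sup>2 else 0)))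
      sums (w ^ Suc m * (1 - (\<Sum>k\<le>m. (x k)\<^sup>2)))"
    by (intro sums_mult sums_diff one sums_If_finite_set) auto
  have "w ^ Suc m * ((x k)\<^sup>2 - (if k \<in> {..m} then (x k)\<^sup>2 else 0)) \<le> w ^ k * (x k)\<^sup>2" for k
    using w1 by (cases "k \<le> m") (auto simp del: power_Suc intro!: mult_right_mono power_increasing)
  then have "w ^ Suc m * (1 - (\<Sum>k\<le>m. (x k)\<^sup>2)) \<le> S"
    using up S by (rule sums_le)
  moreover have "w ^ Suc m * (1/2) \<le> w ^ Suc m * (1 - (\<Sum>k\<le>m. (x k)\<^sup>2))"
    using low w1 by (intro mult_left_mono) auto
  ultimately have "w ^ Suc m * (1/2) \<le> S" by simp
  then have H: "sqrt (w ^ Suc m) * sqrt (1/2) \<le> H_norm lam r x"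
    using H_norm_of_sums[of lam x r S] S lam x0
    by (simp only: w_def real_sqrt_mult[symmetric] real_sqrt_le_mono)
  \<comment> \<open>By maximality of \<open>m\<close>, \<open>\<gamma> / t < a ^ Suc m\<close>, and
    the power \<open>r / \<alpha>\<close> turns \<open>a\<close> into \<open>lam powr r\<close>, the
    square root of \<open>w\<close>.\<close>
  have w_ge: "(\<gamma> / t) powr (r / \<alpha>) \<le> sqrt (w ^ Suc m)"
  proof -
    have "(\<gamma> / t) powr (r / \<alpha>) \<le> (a ^ Suc m) powr (r / \<alpha>)"
      using m t \<gamma> r a by (intro powr_mono2) (auto simp: field_simps)
    also have "\<dots> = (lam powr r) ^ Suc m"
      using a a1 lam by (simp add: powr_realpow[symmetric] powr_powr del: power_Suc) (simp add: powr_powr mult.commute)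
    also have "\<dots> = sqrt (w ^ Suc m)"
    proof -
      have "w = (lam powr r)\<^sup>2" using lam by (simp add: w_def powr_power)
      then show ?thesis by (simp add: real_sqrt_power del: power_Suc)
    qed
    finally show ?thesis .
  qed
  have "sqrt (1/2) * \<gamma> powr (r / \<alpha>) * t powr (- r / \<alpha>) = (\<gamma> / t) powr (r / \<alpha>) * sqrt (1/2)"
    using t \<gamma> by (simp add: powr_divide powr_minus field_simps)
  also have "\<dots> \<le> sqrt (w ^ Suc m) * sqrt (1/2)" by (intro mult_right_mono w_ge) simp
  also note H
  finally show ?thesis .
qed

section \<open>Assembly of the solution and non-uniqueness\<close>

lemma componentwise_solution_subset:
  assumes "componentwise_solution \<alpha> lam J X" and "I \<subseteq> J"
  shows "componentwise_solution \<alpha> lam I X"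
  using assms unfolding componentwise_solution_def
  by (meson continuous_on_subset DERIV_subset subsetD)

theorem theorem1p7:
  fixes \<alpha> lam :: real
  assumes "\<alpha> > 0" and "lam > 1"
  shows "\<exists>X :: real \<Rightarrow> nat \<Rightarrow> real.
     componentwise_solution \<alpha> lam {0<..} X \<and>
     (\<forall>t\<ge>0. \<forall>k. X t k \<ge> 0) \<and>
     X 0 = (\<lambda>k. 0) \<and>
     (\<forall>s<0. continuous_into_H lam s {0..} X) \<and>
     (\<forall>s<\<alpha>. continuous_into_H lam s {0<..} X) \<and>
     (\<forall>s<0. ((\<lambda>t. H_norm lam s (X t)) \<longlongrightarrow> 0) (at_right 0)) \<and>
     (\<forall>t>0. X t \<in> H_space lam 0 \<and> l2_norm lam (X t) = 1) \<and>
     (\<forall>r. 0 < r \<and> r < \<alpha> \<longrightarrow>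
        (\<exists>c>0. \<exists>t\<^sub>r>0. \<forall>t. 0 < t \<and> t \<le> t\<^sub>r \<longrightarrow>
           H_norm lam r (X t) \<ge> c * t powr (- r / \<alpha>))) \<and>
     (let Z = (\<lambda>(t::real) (k::nat). 0 :: real) in
        \<forall>s<0.
          componentwise_solution \<alpha> lam {0..} Z \<and> continuous_into_H lam s {0..} Z \<and>
          componentwise_solution \<alpha> lam {0..} X \<and> continuous_into_H lam s {0..} X \<and>
          Z 0 = X 0 \<and> (\<exists>t\<ge>0. \<exists>k\<ge>1. Z t k \<noteq> X t k))"
proof -
  define a where "a = lam powr \<alpha>"
  have a: "a > 1" using assms by (simp add: a_def)
  have lam0: "lam > 0" using assms by simp
  obtain X where X0: "\<And>t k. t \<ge> 0 \<Longrightarrow> 0 \<le> X t k" and X1: "\<And>t k. t \<ge> 0 \<Longrightarrow> X t k \<le> 1"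
    and Xz: "\<And>t. t \<ge> 0 \<Longrightarrow> X t 0 = 0" and Xi: "\<And>k. X 0 k = 0"
    and Xle: "\<And>t k. t \<ge> 0 \<Longrightarrow> X t k \<le> a ^ k * t"
    and Xcont: "\<And>k. continuous_on {0..} (\<lambda>t. X t k)"
    and Xderiv: "\<And>t k. t \<ge> 0 \<Longrightarrow> k \<ge> 1 \<Longrightarrow> ((\<lambda>u. X u k) has_real_derivative
      a ^ k * (X t (k + 1))\<^sup>2 - a ^ (k - 1) * X t (k - 1) * X t k) (at t within {0..})"
    and Xbd: "\<And>C \<tau>. 1 < C \<Longrightarrow> C < a\<^sup>2 \<Longrightarrow> \<tau> > 0 \<Longrightarrow> \<exists>B. \<forall>t\<ge>\<tau>. \<forall>k. C ^ k * (X t k)\<^sup>2 \<le> B"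
    and Xsums: "\<And>t. t > 0 \<Longrightarrow> (\<lambda>k. (X t k)\<^sup>2) sums 1"
    by (rule anomalous_solution_exists[OF a]) (rule that)
  have rhs: "dyadic_rhs \<alpha> lam z k = a ^ k * (z (k + 1))\<^sup>2 - a ^ (k - 1) * z (k - 1) * z k" for z k
    using lam0 by (simp add: dyadic_rhs_def freq_powr a_def)
  have sol: "componentwise_solution \<alpha> lam {0..} X"
    unfolding componentwise_solution_def
  proof (intro conjI allI impI)
    fix k :: nat assume k: "k \<ge> 1"
    have "continuous_on {0..} (\<lambda>t. dyadic_rhs \<alpha> lam (X t) k)"
      unfolding rhs by (intro continuous_intros Xcont)
    moreover have "((\<lambda>u. X u k) has_real_derivative dyadic_rhs \<alpha> lam (X t) k) (at t within {0..})"
      if "t \<ge> 0" for t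
      unfolding rhs by (rule Xderiv[OF that k])
    ultimately show "\<exists>D. continuous_on {0..} D \<and>
        (\<forall>t\<in>{0..}. ((\<lambda>u. X u k) has_real_derivative D t) (at t within {0..}) \<and>
          D t = dyadic_rhs \<alpha> lam (X t) k)"
      by (intro exI[of _ "\<lambda>t. dyadic_rhs \<alpha> lam (X t) k"]) auto
  qed (use Xz in auto)
  have sol': "componentwise_solution \<alpha> lam {0<..} X"
    by (rule componentwise_solution_subset[OF sol]) auto
  have neg: "continuous_into_H lam s {0..} X" if "s < 0" for s
  \<comment> \<open>For negative \<open>s\<close> the bound \<open>X t k <= 1\<close>, valid down to
    \<open>t = 0\<close>, is already enough.\<close>
  proof (rule continuous_into_H_of_geometric_bound[where C = 1])
    show "lam powr (2 * s) < 1" using that assms by (simp add: powr_less_one)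
    show "\<exists>U B. open U \<and> t \<in> U \<and> (\<forall>u\<in>U \<inter> {0..}. \<forall>k. 1 ^ k * (X u k)\<^sup>2 \<le> B)" if "t \<in> {0..}" for t
      using X0 X1 by (intro exI[of _ UNIV] exI[of _ 1]) (auto simp: abs_square_le_1)
  qed (use lam0 Xz Xcont in auto)
  have pos: "continuous_into_H lam s {0<..} X" if "s < \<alpha>" for s
  proof -
    have "lam powr (2 * s) < lam powr (2 * \<alpha>)" using that assms by simp
    also have "\<dots> = a\<^sup>2" using lam0 by (simp add: a_def powr_power)
    finally have "max 1 (lam powr (2 * s)) < a\<^sup>2" using one_less_power[OF a, of 2] by simp
    \<comment> \<open>\<open>C\<close> must exceed 1 for the energy bound to apply and
      \<open>lam powr (2 * s)\<close> for continuity; \<open>s < \<alpha>\<close> leaves room below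
      \<open>a\<^sup>2\<close>.\<close>
    then obtain C where C: "max 1 (lam powr (2 * s)) < C" "C < a\<^sup>2" using dense by blast
    show ?thesis
    proof (rule continuous_into_H_of_geometric_bound[where C = C])
      fix t :: real assume t: "t \<in> {0<..}"
      then obtain B where "\<forall>u\<ge>t/2. \<forall>k. C ^ k * (X u k)\<^sup>2 \<le> B" using Xbd[of C "t/2"] C by auto
      then show "\<exists>U B. open U \<and> t \<in> U \<and> (\<forall>u\<in>U \<inter> {0<..}. \<forall>k. C ^ k * (X u k)\<^sup>2 \<le> B)"
        using t by (intro exI[of _ "{t/2<..}"] exI[of _ B]) auto
    qed (use lam0 Xz C in \<open>auto intro: continuous_on_subset[OF Xcont]\<close>)
  qed
  have lim: "((\<lambda>t. H_norm lam s (X t)) \<longlongrightarrow> 0) (at_right 0)" if "s < 0" for s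
  proof -
    have "((\<lambda>u. H_norm lam s (\<lambda>k. X u k - X 0 k)) \<longlongrightarrow> 0) (at 0 within {0..})"
      using neg[OF that] by (auto simp: continuous_into_H_def)
    then show ?thesis unfolding Xi by (auto intro: tendsto_within_subset)
  qed
  have one: "X t \<in> H_space lam 0" "l2_norm lam (X t) = 1" if "t > 0" for t
    using in_H_space_of_sums[of lam "X t" 0 1] H_norm_of_sums[of lam "X t" 0 1] Xsums[OF that]
      Xz[of t] that lam0 by auto
  have lower: "\<exists>c>0. \<exists>t\<^sub>r>0. \<forall>t. 0 < t \<and> t \<le> t\<^sub>r \<longrightarrow> H_norm lam r (X t) \<ge> c * t powr (- r / \<alpha>)"
    if r: "0 < r" "r < \<alpha>" for r
  proof -
    define \<gamma> where "\<gamma> = sqrt ((1 - 1 / a\<^sup>2) / 2)"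
    have "(1 - 1 / a\<^sup>2) / 2 > 0" using one_less_power[OF a, of 2] by (simp add: divide_less_eq_1)
    then have \<gamma>: "\<gamma>\<^sup>2 = (1 - 1 / a\<^sup>2) / 2" "\<gamma> > 0" by (simp_all add: \<gamma>_def)
    have "H_norm lam r (X t) \<ge> sqrt (1/2) * \<gamma> powr (r / \<alpha>) * t powr (- r / \<alpha>)" if "0 < t" "t \<le> \<gamma>" for t
    proof (rule H_norm_lower_bound[OF assms(2) r(1) a_def assms(1)])
      show "X t \<in> H_space lam r" using pos[OF r(2)] that by (auto simp: continuous_into_H_def)
    qed (use that \<gamma> Xz X0 Xle Xsums in auto)
    then show ?thesis using \<gamma>
      by (intro exI[of _ "sqrt (1/2) * \<gamma> powr (r / \<alpha>)"] exI[of _ \<gamma>] conjI) auto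
  qed
  have "componentwise_solution \<alpha> lam {0..} (\<lambda>t k. 0)"
    by (auto simp: componentwise_solution_def dyadic_rhs_def intro!: exI[of _ "\<lambda>_. 0"])
  moreover have "continuous_into_H lam s {0..} (\<lambda>t k. 0)" for s
    by (auto simp: continuous_into_H_def H_space_def H_norm_def)
  moreover have "\<exists>t\<ge>0. \<exists>k\<ge>1. 0 \<noteq> X t k"
  proof -
    have "\<exists>k. X 1 k \<noteq> 0"
    proof (rule ccontr)
      assume "\<not> (\<exists>k. X 1 k \<noteq> 0)"
      then show False using Xsums[of 1] sums_unique2[of "\<lambda>_. 0 :: real" 0 1] by simp
    qed
    then obtain k where "X 1 k \<noteq> 0" ..
    moreover from this have "k \<ge> 1" using Xz[of 1] by (cases k) auto
    ultimately show ?thesis by (intro exI[of _ 1] exI[of _ k] conjI) auto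
  qed
  ultimately show ?thesis
    using sol sol' X0 Xi neg pos lim one lower
    unfolding Let_def by (intro exI[of _ X]) auto
qed

end
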